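(* The collection of all simplified three-dimensional copulas with positive density is nowhere dense in $(\mathcal{C}^3_{{\rm ac},>0},KL)$, i.e. in the set of absolutely continuous three-dimensional copulas with positive density, endowed with the topology of convergence in Kullback–Leibler divergence.
   Context: $\mathbb{I}=[0,1]$, $\lambda^k$ Lebesgue measure. $\mathcal{C}^3_{{\rm ac},>0}$ is the set of absolutely continuous three-dimensional copulas whose density is positive $\lambda^3$-a.e.; for such $C_1,C_2$ with densities $c_1,c_2$ the Kullback–Leibler divergence is $KL(C_1,C_2)=\int_{\mathbb{I}^3}c_1\log(c_1/c_2)\,d\lambda^3$. Points are written $(\mathbf{u},v)$, $\mathbf{u}=(u_1,u_2)$. For a copula $C$, $K_C$ is (a version of) the regular conditional distribution of $(U_1,U_2)$ given $U_3=v$, $(U_1,U_2,U_3)\sim C$; $F_{1|3}(u_1|t)=K_C(t,[0,u_1]\times\mathbb{I})$, $F_{2|3}(u_2|t)=K_C(t,\mathbb{I}\times[0,u_2])$. $C$ is simplified if there is a bivariate copula $A$ with $C(\mathbf{u},v)=\int_{[0,v]}A(F_{1|3}(u_1|t),F_{2|3}(u_2|t))\,d\lambda(t)$ for all $(\mathbf{u},v)$ and, for $\lambda$-a.e. $t$, $F_{1|3}(\cdot|t)$, $F_{2|3}(\cdot|t)$ are continuous. *)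

theory Defs
  imports "HOL-Probability.Probability"
begin

text \<open>Points of the unit cube are written ((u1,u2),v).  Copulas are represented by
their (distribution) functions; by convention they vanish off the unit cube/square,
so that each copula has exactly one representative.\<close>

type_synonym pt3 = "(real \<times> real) \<times> real"

definition I2 :: "(real \<times> real) set" where
  "I2 = {0..1} \<times> {0..1}"

definition I3 :: "pt3 set" where
  "I3 = ({0..1} \<times> {0..1}) \<times> {0..1}"

definition copula2_measure :: "(real \<times> real) measure \<Rightarrow> (real \<times> real \<Rightarrow> real) \<Rightarrow> bool" where
  "copula2_measure \<mu> A \<longleftrightarrow>
     sets \<mu> = sets borel \<and> prob_space \<mu> \<and> emeasure \<mu> I2 = 1 \<and>
     (\<forall>x\<in>{0..1}. emeasure \<mu> ({0..x} \<times> {0..1}) = ennreal x) \<and>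
     (\<forall>x\<in>{0..1}. emeasure \<mu> ({0..1} \<times> {0..x}) = ennreal x) \<and>
     (\<forall>u1\<in>{0..1}. \<forall>u2\<in>{0..1}. A (u1, u2) = measure \<mu> ({0..u1} \<times> {0..u2}))"

definition is_copula2 :: "(real \<times> real \<Rightarrow> real) \<Rightarrow> bool" where
  "is_copula2 A \<longleftrightarrow> (\<exists>\<mu>. copula2_measure \<mu> A) \<and> (\<forall>x. x \<notin> I2 \<longrightarrow> A x = 0)"

definition copula3_measure :: "pt3 measure \<Rightarrow> (pt3 \<Rightarrow> real) \<Rightarrow> bool" where
  "copula3_measure \<mu> C \<longleftrightarrow>
     sets \<mu> = sets borel \<and> prob_space \<mu> \<and> emeasure \<mu> I3 = 1 \<and>
     (\<forall>x\<in>{0..1}. emeasure \<mu> (({0..x} \<times> {0..1}) \<times> {0..1}) = ennreal x) \<and>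
     (\<forall>x\<in>{0..1}. emeasure \<mu> (({0..1} \<times> {0..x}) \<times> {0..1}) = ennreal x) \<and>
     (\<forall>x\<in>{0..1}. emeasure \<mu> (({0..1} \<times> {0..1}) \<times> {0..x}) = ennreal x) \<and>
     (\<forall>u1\<in>{0..1}. \<forall>u2\<in>{0..1}. \<forall>v\<in>{0..1}.
        C ((u1, u2), v) = measure \<mu> (({0..u1} \<times> {0..u2}) \<times> {0..v}))"

definition is_copula3 :: "(pt3 \<Rightarrow> real) \<Rightarrow> bool" where
  "is_copula3 C \<longleftrightarrow> (\<exists>\<mu>. copula3_measure \<mu> C) \<and> (\<forall>x. x \<notin> I3 \<longrightarrow> C x = 0)"

definition is_density3 :: "(pt3 \<Rightarrow> real) \<Rightarrow> (pt3 \<Rightarrow> real) \<Rightarrow> bool" where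
  "is_density3 C c \<longleftrightarrow>
     c \<in> borel_measurable borel \<and> (\<forall>x\<in>I3. 0 \<le> c x) \<and> set_integrable lborel I3 c \<and>
     (\<forall>u1\<in>{0..1}. \<forall>u2\<in>{0..1}. \<forall>v\<in>{0..1}.
        C ((u1, u2), v) = (\<integral>x\<in>({0..u1} \<times> {0..u2}) \<times> {0..v}. c x \<partial>lborel))"

definition Cac_pos :: "(pt3 \<Rightarrow> real) set" where
  "Cac_pos = {C. is_copula3 C \<and>
     (\<exists>c. is_density3 C c \<and> (AE x in lborel. x \<in> I3 \<longrightarrow> 0 < c x))}"

definition density3 :: "(pt3 \<Rightarrow> real) \<Rightarrow> pt3 \<Rightarrow> real" where
  "density3 C = (SOME c. is_density3 C c)"

text \<open>Kullback--Leibler divergence, with value +infinity when the integrand is not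
integrable (its negative part is always integrable, so this is the usual convention).\<close>
definition KL :: "(pt3 \<Rightarrow> real) \<Rightarrow> (pt3 \<Rightarrow> real) \<Rightarrow> ereal" where
  "KL C1 C2 =
     (let c1 = density3 C1; c2 = density3 C2; f = (\<lambda>x. c1 x * ln (c1 x / c2 x))
      in if set_integrable lborel I3 f then ereal (\<integral>x\<in>I3. f x \<partial>lborel) else \<infinity>)"

definition KL_top :: "(pt3 \<Rightarrow> real) topology" where
  "KL_top = topology (\<lambda>U. U \<subseteq> Cac_pos \<and>
     (\<forall>C\<in>U. \<forall>s. (\<forall>n. s n \<in> Cac_pos) \<and> (\<lambda>n. KL (s n) C) \<longlonglongrightarrow> 0
          \<longrightarrow> eventually (\<lambda>n. s n \<in> U) sequentially))"

text \<open>K is a version of the regular conditional distribution of (U1,U2) given U3 = t,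
where (U1,U2,U3) ~ mu (U3 is uniform on [0,1]).\<close>
definition cond_kernel :: "pt3 measure \<Rightarrow> (real \<Rightarrow> (real \<times> real) measure) \<Rightarrow> bool" where
  "cond_kernel \<mu> K \<longleftrightarrow>
     (\<forall>t. prob_space (K t) \<and> sets (K t) = sets borel) \<and>
     (\<forall>E\<in>sets borel. (\<lambda>t. measure (K t) E) \<in> borel_measurable borel) \<and>
     (\<forall>E\<in>sets borel. \<forall>F\<in>sets borel.
        emeasure \<mu> (E \<times> F) = (\<integral>\<^sup>+ t. indicator (F \<inter> {0..1}) t * emeasure (K t) E \<partial>lborel))"

definition F13 :: "(real \<Rightarrow> (real \<times> real) measure) \<Rightarrow> real \<Rightarrow> real \<Rightarrow> real" where
  "F13 K u1 t = measure (K t) ({0..u1} \<times> {0..1})"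

definition F23 :: "(real \<Rightarrow> (real \<times> real) measure) \<Rightarrow> real \<Rightarrow> real \<Rightarrow> real" where
  "F23 K u2 t = measure (K t) ({0..1} \<times> {0..u2})"

definition simplified :: "(pt3 \<Rightarrow> real) \<Rightarrow> bool" where
  "simplified C \<longleftrightarrow> (\<exists>\<mu> K A. copula3_measure \<mu> C \<and> cond_kernel \<mu> K \<and> is_copula2 A \<and>
     (\<forall>u1\<in>{0..1}. \<forall>u2\<in>{0..1}. \<forall>v\<in>{0..1}.
        C ((u1, u2), v) = (\<integral>t\<in>{0..v}. A (F13 K u1 t, F23 K u2 t) \<partial>lborel)) \<and>
     (AE t in lborel. t \<in> {0..1} \<longrightarrow>
        continuous_on {0..1} (\<lambda>u. F13 K u t) \<and> continuous_on {0..1} (\<lambda>u. F23 K u t)))"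

end

theory Submission
  imports Defs
begin

text \<open>
  Write \<open>H t\<close>, \<open>x t\<close>, \<open>y t\<close> for the mass that the conditional law of \<open>(U1, U2)\<close> given \<open>U3 = t\<close> assigns to
  \<open>[0, 1/2] \<times> [0, 1/2]\<close>, \<open>[0, 1/2] \<times> [0, 1]\<close>, \<open>[0, 1] \<times> [0, 1/2]\<close>. For a simplified copula \<open>H = A(x, y)\<close> a.e. with a
  bivariate copula \<open>A\<close>, and copulas are Lipschitz, so
  \<open>\<bar>H s - H t\<bar> \<le> \<bar>x s - x t\<bar> + \<bar>y s - y t\<bar>\<close> for almost all \<open>s\<close> and \<open>t\<close>. This condition is stable
  under convergence of densities in \<open>L\<^sup>1\<close>, hence under convergence in Kullback--Leibler divergence, so it defines
  a closed set containing all simplified copulas.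

  Its interior is empty. Given a density \<open>p\<close>, let \<open>k(u, t)\<close> be the minimum of \<open>p\<close> over the four images of \<open>(u, t)\<close>
  under the reflections \<open>u\<^sub>i \<mapsto> 1 - u\<^sub>i\<close>, with the sign \<open>sgn(1/2 - u\<^sub>1) sgn(1/2 - u\<^sub>2)\<close>. Adding \<open>\<epsilon> 1\<^sub>B(t) k(u, t)\<close>
  to \<open>p\<close> changes neither \<open>x\<close>, \<open>y\<close> nor the margins, and costs divergence \<open>O(\<epsilon>)\<close> because \<open>\<bar>k\<bar> \<le> p\<close>; but it raises
  \<open>H\<close> on \<open>B\<close> by a positive amount. If \<open>B\<close> is a proper part of a set of positive measure on which \<open>H\<close>, \<open>x\<close>, \<open>y\<close>
  hardly oscillate, the Lipschitz condition fails.
\<close>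

subsection \<open>Measures\<close>

lemma (in finite_measure) abs_measure_diff_le:
  assumes "A \<in> sets M" "B \<in> sets M" "D \<in> sets M" "A - B \<subseteq> D" "B - A \<subseteq> D"
  shows "\<bar>measure M A - measure M B\<bar> \<le> measure M D"
proof -
  have "measure M X \<le> measure M Y + measure M D"
    if "X \<in> sets M" "Y \<in> sets M" "X - Y \<subseteq> D" for X Y
  proof -
    have "measure M X \<le> measure M (Y \<union> D)"
      using that assms(3) by (intro finite_measure_mono) auto
    also have "\<dots> \<le> measure M Y + measure M D"
      using that assms(3) by (intro measure_Un_le)
    finally show ?thesis .
  qed
  from this[of A B] this[of B A] assms show ?thesis by auto
qed

lemma AE_obtain_in_positive_set:
  assumes "AE x in M. P x" "A \<in> sets M" "emeasure M A \<noteq> 0"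
  obtains x where "x \<in> A" "P x"
proof -
  have "\<exists>x\<in>A. P x"
  proof (rule ccontr)
    assume "\<not> ?thesis"
    with assms(1) have "AE x in M. x \<notin> A" by (auto elim!: AE_mp)
    then show False
      using assms(2,3) by (simp add: AE_iff_null_sets[symmetric] null_sets_def)
  qed
  then show ?thesis using that by blast
qed

lemma positive_measure_bounded_below:
  fixes f :: "'a \<Rightarrow> real"
  assumes [measurable]: "f \<in> borel_measurable M" "A \<in> sets M"
    and A: "emeasure M A \<noteq> 0" and pos: "AE x\<in>A in M. 0 < f x"
  obtains B \<delta> where "B \<in> sets M" "B \<subseteq> A" "emeasure M B \<noteq> 0" "0 < \<delta>" "\<And>x. x \<in> B \<Longrightarrow> \<delta> \<le> f x"
proof -
  let ?g = "\<lambda>x. indicator A x * f x"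
  have "\<exists>B \<delta>. B \<in> sets M \<and> \<delta> > 0 \<and> emeasure M B > 0 \<and> (\<forall>x\<in>B. \<delta> \<le> ?g x)"
  proof (rule not_AE_zero_E)
    show "AE x in M. 0 \<le> ?g x"
      using pos by eventually_elim (auto simp: indicator_def)
    show "\<not> (AE x in M. ?g x = 0)"
    proof
      assume "AE x in M. ?g x = 0"
      with pos have "AE x in M. (x \<in> A \<longrightarrow> 0 < f x) \<and> ?g x = 0"
        by (rule AE_conjI)
      then obtain x where "x \<in> A" "(x \<in> A \<longrightarrow> 0 < f x) \<and> ?g x = 0"
        using assms(2) A by (rule AE_obtain_in_positive_set)
      then show False by auto
    qed
  qed measurable
  then obtain B \<delta> where B: "B \<in> sets M" "0 < \<delta>" "0 < emeasure M B" "\<And>x. x \<in> B \<Longrightarrow> \<delta> \<le> ?g x"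
    by blast
  have bound: "x \<in> A \<and> \<delta> \<le> f x" if "x \<in> B" for x
    using B(4)[OF that] B(2) by (cases "x \<in> A") auto
  show ?thesis
    by (rule that[of B \<delta>]) (use B bound in auto)
qed

lemma positive_measure_small_oscillation:
  fixes f :: "'a \<Rightarrow> 'b::{metric_space, second_countable_topology}"
  assumes [measurable]: "f \<in> borel_measurable M" "A \<in> sets M"
    and pos: "emeasure M A \<noteq> 0" and e_pos: "0 < e"
  obtains B where "B \<in> sets M" "B \<subseteq> A" "emeasure M B \<noteq> 0"
    "\<And>x y. x \<in> B \<Longrightarrow> y \<in> B \<Longrightarrow> dist (f x) (f y) < e"
proof -
  obtain D :: "'b set" where D: "countable D" "\<And>U. open U \<Longrightarrow> U \<noteq> {} \<Longrightarrow> \<exists>d\<in>D. d \<in> U"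
    using countable_dense_exists by blast
  define Q where "Q d = A \<inter> (f -` ball d (e / 2) \<inter> space M)" for d
  have Q: "Q d \<in> sets M" for d
    unfolding Q_def by measurable
  have cover: "x \<in> (\<Union>d\<in>D. Q d)" if "x \<in> A" for x
  proof -
    obtain d where "d \<in> D" "d \<in> ball (f x) (e / 2)"
      using D(2)[of "ball (f x) (e / 2)"] e_pos by auto
    then show ?thesis
      using that sets.sets_into_space[OF assms(2)] by (auto simp: Q_def dist_commute)
  qed
  have "\<exists>d\<in>D. emeasure M (Q d) \<noteq> 0"
  proof (rule ccontr)
    assume "\<not> ?thesis"
    then have "(\<Union>d\<in>D. Q d) \<in> null_sets M"
      using D(1) Q by (intro null_sets_UN') auto
    then have "A \<in> null_sets M"
      by (rule null_sets_subset) (use cover in auto)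
    then show False using pos by auto
  qed
  then obtain d where "emeasure M (Q d) \<noteq> 0" by blast
  moreover have "dist (f x) (f y) < e" if "x \<in> Q d" "y \<in> Q d" for x y
    using that dist_triangle_half_r[of d "f x" e "f y"] by (auto simp: Q_def)
  ultimately show ?thesis
    using that[of "Q d"] Q by (auto simp: Q_def)
qed

text \<open>If \<open>A\<close> could not be split, it would agree up to null sets with subsets of arbitrarily small diameter,
  hence with a single point.\<close>
lemma atomless_split_positive_measure:
  fixes M :: "'a::{metric_space, second_countable_topology} measure"
  assumes sets[measurable_cong]: "sets M = sets borel" and atomless: "\<And>x. emeasure M {x} = 0"
    and A: "A \<in> sets M" "emeasure M A \<noteq> 0"
  obtains B where "B \<in> sets M" "B \<subseteq> A" "emeasure M B \<noteq> 0" "emeasure M (A - B) \<noteq> 0"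
proof (rule ccontr)
  assume no_split: "\<not> thesis"
  have "\<exists>B\<in>sets M. B \<subseteq> A \<and> emeasure M B \<noteq> 0 \<and> (\<forall>x\<in>B. \<forall>y\<in>B. dist x y < 1 / Suc n)" for n
    by (rule positive_measure_small_oscillation[of "\<lambda>x. x" M A "1 / Suc n"]) (use A in auto)
  then obtain B where B: "\<And>n. B n \<in> sets M" "\<And>n. B n \<subseteq> A" "\<And>n. emeasure M (B n) \<noteq> 0"
    and small: "\<And>n x y. x \<in> B n \<Longrightarrow> y \<in> B n \<Longrightarrow> dist x y < 1 / Suc n"
    by metis
  have "A - B n \<in> null_sets M" for n
    using no_split that[OF B] A(1) B(1) by (auto intro!: null_setsI)
  then have "(\<Union>n. A - B n) \<in> null_sets M"
    by (intro null_sets_UN)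
  moreover have "(\<Inter>n. B n) \<in> null_sets M"
  proof (cases "(\<Inter>n. B n) = {}")
    case False
    then obtain x where x: "x \<in> (\<Inter>n. B n)" by blast
    have "y = x" if "y \<in> (\<Inter>n. B n)" for y
    proof (rule ccontr)
      assume "y \<noteq> x"
      then obtain n where "1 / Suc n < dist y x"
        using nat_approx_posE[of "dist y x"] by auto
      moreover have "dist y x < 1 / Suc n"
        using that x by (intro small) auto
      ultimately show False by simp
    qed
    with x have "(\<Inter>n. B n) = {x}" by blast
    then show ?thesis
      using atomless by (auto intro!: null_setsI simp: sets)
  qed simp
  ultimately have "(\<Union>n. A - B n) \<union> (\<Inter>n. B n) \<in> null_sets M"
    by (rule null_sets.Un)
  then have "A \<in> null_sets M"
    by (rule null_sets_subset[OF _ A(1)]) blast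
  then show False using A(2) by auto
qed

lemma measure_eqI_atMost:
  fixes M N :: "'a::ordered_euclidean_space measure"
  assumes sets: "sets M = sets borel" "sets N = sets borel"
    and eq: "\<And>a. emeasure M {..a} = emeasure N {..a}" and fin: "finite_measure N"
  shows "M = N"
proof (rule measure_eqI_generator_eq[where E = "range atMost" and \<Omega> = UNIV
      and A = "\<lambda>i. {.. real i *\<^sub>R One}"])
  show "Int_stable (range (atMost :: 'a \<Rightarrow> 'a set))"
  proof (rule Int_stableI)
    fix X Y assume "X \<in> range (atMost :: 'a \<Rightarrow> 'a set)" "Y \<in> range (atMost :: 'a \<Rightarrow> 'a set)"
    then obtain a b where "X = {..a}" "Y = {..b}" by auto
    then have "X \<inter> Y = {..inf a b}" by auto
    then show "X \<inter> Y \<in> range atMost" by blast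
  qed
  show "(\<Union>i. {.. real i *\<^sub>R (One::'a)}) = UNIV"
  proof (intro equalityI subsetI UNIV_I)
    fix x :: 'a
    obtain n :: nat where "norm x \<le> real n"
      using real_arch_simple by blast
    then have "x \<bullet> b \<le> real n" if "b \<in> Basis" for b
      using Basis_le_norm[OF that, of x] by linarith
    then show "x \<in> (\<Union>i. {.. real i *\<^sub>R (One::'a)})"
      by (auto simp: eucl_le[where 'a='a])
  qed
qed (use eq finite_measure.emeasure_finite[OF fin] in \<open>auto simp: sets borel_eq_atMost\<close>)

lemma emeasure_density_set_integral:
  fixes f :: "'a \<Rightarrow> real"
  assumes "integrable M f" "\<And>x. 0 \<le> f x" "A \<in> sets M"
  shows "emeasure (density M (\<lambda>x. ennreal (f x))) A = ennreal (\<integral>x\<in>A. f x \<partial>M)"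
  using assms by (subst emeasure_density) (auto intro!: nn_set_integral_eq_set_integral)

lemma AE_eq_on_Icc_if_set_integral_eq:
  fixes f g :: "'a::ordered_euclidean_space \<Rightarrow> real"
  assumes f: "set_integrable lborel {a..b} f" "\<And>x. x \<in> {a..b} \<Longrightarrow> 0 \<le> f x"
    and g: "set_integrable lborel {a..b} g" "\<And>x. x \<in> {a..b} \<Longrightarrow> 0 \<le> g x"
    and eq: "\<And>c. c \<in> {a..b} \<Longrightarrow> (\<integral>x\<in>{a..c}. f x \<partial>lborel) = (\<integral>x\<in>{a..c}. g x \<partial>lborel)"
  shows "AE x\<in>{a..b} in lborel. f x = g x"
proof -
  define extend where "extend h = (\<lambda>x. indicator {a..b} x * h x)" for h :: "'a \<Rightarrow> real"
  have int: "integrable lborel (extend f)" "integrable lborel (extend g)"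
    using f(1) g(1) by (auto simp: extend_def set_integrable_def)
  have nonneg: "0 \<le> extend f x" "0 \<le> extend g x" for x
    using f(2) g(2) by (auto simp: extend_def indicator_def)
  have restrict: "(\<integral>x\<in>{..c}. extend h x \<partial>lborel) = (\<integral>x\<in>{a..inf b c}. h x \<partial>lborel)" for h c
    unfolding extend_def set_lebesgue_integral_def
    by (intro Bochner_Integration.integral_cong) (auto simp: indicator_def)
  have "(\<integral>x\<in>{..c}. extend f x \<partial>lborel) = (\<integral>x\<in>{..c}. extend g x \<partial>lborel)" for c
  proof (cases "a \<le> inf b c")
    case True
    then show ?thesis unfolding restrict by (intro eq) simp
  next
    case False
    then have "{a..inf b c} = {}" by simp
    then show ?thesis unfolding restrict by (simp add: set_lebesgue_integral_def)
  qed
  then have "density lborel (\<lambda>x. ennreal (extend f x)) = density lborel (\<lambda>x. ennreal (extend g x))"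
    using int nonneg
    by (intro measure_eqI_atMost finite_measureI) (simp_all add: emeasure_density_set_integral)
  then have "AE x in lborel. ennreal (extend f x) = ennreal (extend g x)"
    using int by (subst (asm) sigma_finite_measure.density_unique_iff[OF sigma_finite_lborel]) auto
  then show ?thesis
    using nonneg by (auto simp: ennreal_inj extend_def indicator_def elim: eventually_mono)
qed

lemma set_integrable_lborel_bounded:
  fixes f :: "'a::euclidean_space \<Rightarrow> real"
  assumes "f \<in> borel_measurable borel" "S \<in> sets borel" "bounded S" "\<And>x. x \<in> S \<Longrightarrow> \<bar>f x\<bar> \<le> K"
  shows "set_integrable lborel S f"
  unfolding set_integrable_def using assms emeasure_bounded_finite[of S]
  by (intro integrableI_bounded_set_indicator[where B = K]) auto

lemma set_integral_antisymmetric_eq_0: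
  fixes f :: "'a \<Rightarrow> real"
  assumes T: "T \<in> measurable M N" and inv: "distr M N T = M"
    and f: "set_borel_measurable M A f" and A: "\<And>x. T x \<in> A \<longleftrightarrow> x \<in> A"
    and anti: "\<And>x. f (T x) = - f x"
  shows "(\<integral>x\<in>A. f x \<partial>M) = 0"
proof -
  have sets: "sets N = sets M"
    using inv by (metis sets_distr)
  have meas: "(\<lambda>x. indicator A x *\<^sub>R f x) \<in> borel_measurable N"
    using f unfolding set_borel_measurable_def measurable_cong_sets[OF sets refl] .
  have "(\<integral>x\<in>A. f x \<partial>M) = (\<integral>x\<in>A. f x \<partial>distr M N T)"
    by (simp add: inv)
  also have "\<dots> = (\<integral>x. indicator A (T x) *\<^sub>R f (T x) \<partial>M)"
    unfolding set_lebesgue_integral_def using T meas by (rule integral_distr)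
  also have "\<dots> = - (\<integral>x\<in>A. f x \<partial>M)"
    by (simp add: set_lebesgue_integral_def anti A indicator_def)
  finally show ?thesis by simp
qed

lemma (in pair_sigma_finite) AE_pair_swap:
  assumes "AE z in M1 \<Otimes>\<^sub>M M2. P z"
  shows "AE y in M2. AE x in M1. P (x, y)"
proof -
  interpret swap: pair_sigma_finite M2 M1 ..
  have "AE z in M2 \<Otimes>\<^sub>M M1. P (case z of (y, x) \<Rightarrow> (x, y))"
    using assms by (subst (asm) distr_pair_swap) (rule AE_distrD[OF measurable_pair_swap'])
  from swap.AE_pair[OF this] show ?thesis by simp
qed

lemma distr_lborel_map_prod:
  fixes f :: "'a::euclidean_space \<Rightarrow> 'a" and g :: "'b::euclidean_space \<Rightarrow> 'b"
  assumes [measurable]: "f \<in> borel_measurable borel" "g \<in> borel_measurable borel"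
    and f: "distr lborel borel f = lborel" and g: "distr lborel borel g = lborel"
  shows "distr lborel borel (map_prod f g) = lborel"
proof -
  have "distr lborel borel f \<Otimes>\<^sub>M distr lborel borel g =
      distr (lborel \<Otimes>\<^sub>M lborel) (borel \<Otimes>\<^sub>M borel) (\<lambda>(x, y). (f x, g y))"
    by (intro pair_measure_distr) (auto simp: g lborel.sigma_finite_measure_axioms)
  then show ?thesis
    by (simp add: f g lborel_prod borel_prod map_prod_def)
qed

subsection \<open>Sections of integrable functions\<close>

definition slice :: "('a::euclidean_space \<times> 'b::euclidean_space \<Rightarrow> real) \<Rightarrow> 'a set \<Rightarrow> 'b \<Rightarrow> real" where
  "slice p E t = (\<integral>u\<in>E. p (u, t) \<partial>lborel)"

lemma integrable_imp_set_integrable: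
  fixes f :: "'a \<Rightarrow> 'b::{banach, second_countable_topology}"
  shows "integrable M f \<Longrightarrow> A \<in> sets M \<Longrightarrow> set_integrable M A f"
  unfolding set_integrable_def by (rule integrable_mult_indicator)

lemma
  fixes p :: "'a::euclidean_space \<times> 'b::euclidean_space \<Rightarrow> real"
  assumes p: "integrable lborel p"
  shows AE_integrable_section: "AE t in lborel. integrable lborel (\<lambda>u. p (u, t))"
    and integrable_slice: "E \<in> sets borel \<Longrightarrow> integrable lborel (slice p E)"
    and set_integral_Times_eq_slice: "E \<in> sets borel \<Longrightarrow> F \<in> sets borel \<Longrightarrow>
      (\<integral>x\<in>E \<times> F. p x \<partial>lborel) = (\<integral>t\<in>F. slice p E t \<partial>lborel)"
proof -
  have pair: "integrable (lborel \<Otimes>\<^sub>M lborel) (\<lambda>(u, t). indicator (E \<times> F) (u, t) *\<^sub>R p (u, t))"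
    if "E \<in> sets borel" "F \<in> sets borel" for E F
    using integrable_mult_indicator[OF _ p, of "E \<times> F"] that by (simp add: borel_Times lborel_prod case_prod_beta')
  from lborel_pair.AE_integrable_snd[OF pair[of UNIV UNIV]]
  show "AE t in lborel. integrable lborel (\<lambda>u. p (u, t))" by simp
  show "integrable lborel (slice p E)" if "E \<in> sets borel"
    using lborel_pair.integrable_snd[OF pair[OF that, of UNIV]]
    by (simp add: slice_def[abs_def] set_lebesgue_integral_def indicator_times)
  show "(\<integral>x\<in>E \<times> F. p x \<partial>lborel) = (\<integral>t\<in>F. slice p E t \<partial>lborel)"
    if "E \<in> sets borel" "F \<in> sets borel"
    using lborel_pair.integral_snd[OF pair[OF that]]
    by (simp add: slice_def set_lebesgue_integral_def indicator_times lborel_prod case_prod_unfold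
        mult.assoc mult.left_commute[of "indicator E _"])
qed

lemma AE_section:
  fixes P :: "'a::euclidean_space \<times> 'b::euclidean_space \<Rightarrow> bool"
  assumes "AE x in lborel. P x"
  shows "AE t in lborel. AE u in lborel. P (u, t)"
  by (rule lborel_pair.AE_pair_swap) (use assms in \<open>simp only: lborel_prod\<close>)

lemma AE_abs_slice_diff_le:
  assumes "integrable lborel p" "integrable lborel q"
  shows "AE t in lborel. \<forall>E\<in>sets borel.
    \<bar>slice p E t - slice q E t\<bar> \<le> slice (\<lambda>x. \<bar>p x - q x\<bar>) UNIV t"
  using AE_integrable_section[OF assms(1)] AE_integrable_section[OF assms(2)]
proof eventually_elim
  case (elim t)
  show ?case
  proof
    fix E :: "'a set" assume E: "E \<in> sets borel"
    let ?d = "\<lambda>u. p (u, t) - q (u, t)"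
    have d: "set_integrable lborel E ?d" "set_integrable lborel UNIV ?d"
      using elim E by (auto intro!: integrable_imp_set_integrable)
    have "\<bar>slice p E t - slice q E t\<bar> = \<bar>\<integral>u\<in>E. ?d u \<partial>lborel\<bar>"
      using elim E by (simp add: slice_def integrable_imp_set_integrable)
    also have "\<dots> \<le> (\<integral>u. \<bar>indicator E u *\<^sub>R ?d u\<bar> \<partial>lborel)"
      unfolding set_lebesgue_integral_def by (rule integral_abs_bound)
    also have "\<dots> \<le> (\<integral>u\<in>UNIV. \<bar>?d u\<bar> \<partial>lborel)"
      using d unfolding set_lebesgue_integral_def set_integrable_def
      by (intro integral_mono) (auto split: split_indicator)
    finally show "\<bar>slice p E t - slice q E t\<bar> \<le> slice (\<lambda>x. \<bar>p x - q x\<bar>) UNIV t"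
      by (simp add: slice_def)
  qed
qed

lemma L1_tendsto_imp_AE_slice_tendsto_subseq:
  assumes p: "\<And>n. integrable lborel (p n)" and q: "integrable lborel q"
    and lim: "(\<lambda>n. \<integral>x. \<bar>p n x - q x\<bar> \<partial>lborel) \<longlonglongrightarrow> 0"
  obtains r :: "nat \<Rightarrow> nat" where "strict_mono r"
    "AE t in lborel. \<forall>E\<in>sets borel. (\<lambda>n. slice (p (r n)) E t) \<longlonglongrightarrow> slice q E t"
proof -
  define D where "D n = slice (\<lambda>x. \<bar>p n x - q x\<bar>) UNIV" for n
  have int: "integrable lborel (\<lambda>x. \<bar>p n x - q x\<bar>)" for n
    using p q by auto
  have D: "integrable lborel (D n)" for n
    unfolding D_def by (intro integrable_slice int) auto
  have "0 \<le> D n t" for n t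
    by (simp add: D_def slice_def set_lebesgue_integral_def)
  then have "(\<integral>t. norm (D n t) \<partial>lborel) = (\<integral>x. \<bar>p n x - q x\<bar> \<partial>lborel)" for n
    using set_integral_Times_eq_slice[OF int, of UNIV UNIV n]
    by (simp add: D_def set_lebesgue_integral_def)
  then obtain r :: "nat \<Rightarrow> nat" where r: "strict_mono r" "AE t in lborel. (\<lambda>n. D (r n) t) \<longlonglongrightarrow> 0"
    using tendsto_L1_AE_subseq[of lborel D] D lim by auto
  have "AE t in lborel. \<forall>n. \<forall>E\<in>sets borel. \<bar>slice (p (r n)) E t - slice q E t\<bar> \<le> D (r n) t"
    unfolding AE_all_countable D_def using AE_abs_slice_diff_le[OF p q] by blast
  with r(2) have "AE t in lborel. \<forall>E\<in>sets borel. (\<lambda>n. slice (p (r n)) E t) \<longlonglongrightarrow> slice q E t"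
  proof eventually_elim
    case (elim t)
    show ?case
    proof
      fix E :: "'a set" assume "E \<in> sets borel"
      with elim have "(\<lambda>n. slice (p (r n)) E t - slice q E t) \<longlonglongrightarrow> 0"
        by (intro Lim_null_comparison[OF always_eventually elim(1)]) simp
      then show "(\<lambda>n. slice (p (r n)) E t) \<longlonglongrightarrow> slice q E t"
        by (simp add: LIM_zero_iff)
    qed
  qed
  with r(1) show ?thesis by (rule that)
qed

subsection \<open>Densities of copulas\<close>

abbreviation box3 :: "real \<Rightarrow> real \<Rightarrow> real \<Rightarrow> pt3 set" where
  "box3 u1 u2 v \<equiv> ({0..u1} \<times> {0..u2}) \<times> {0..v}"

lemma borel_Times_Icc [measurable, simp]:
  "{a..b} \<times> {c..d} \<in> sets (borel :: (real \<times> real) measure)"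
  by (simp add: borel_Times)

lemma borel_box3 [measurable, simp]: "box3 u1 u2 v \<in> sets borel"
  by (simp add: borel_Times)

lemma borel_I3 [measurable, simp]: "I3 \<in> sets borel"
  by (simp add: I3_def)

lemma is_density3_unique:
  assumes c: "is_density3 C c" and d: "is_density3 C d"
  shows "AE x\<in>I3 in lborel. c x = d x"
proof -
  have I3: "I3 = {((0, 0), 0)..((1, 1), 1)}"
    by (simp add: I3_def atLeastAtMost_prod_eq)
  have "(\<integral>x\<in>{((0, 0), 0)..z}. c x \<partial>lborel) = (\<integral>x\<in>{((0, 0), 0)..z}. d x \<partial>lborel)"
    if "z \<in> I3" for z
  proof -
    obtain u1 u2 v where z: "z = ((u1, u2), v)" by (metis prod.collapse)
    then have "u1 \<in> {0..1}" "u2 \<in> {0..1}" "v \<in> {0..1}"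
      using that by (auto simp: I3_def)
    then have "(\<integral>x\<in>box3 u1 u2 v. c x \<partial>lborel) = (\<integral>x\<in>box3 u1 u2 v. d x \<partial>lborel)"
      using c d unfolding is_density3_def by metis
    then show ?thesis by (simp add: z atLeastAtMost_prod_eq)
  qed
  with c d show ?thesis
    unfolding I3 by (intro AE_eq_on_Icc_if_set_integral_eq) (auto simp: is_density3_def I3)
qed

definition cube_density :: "(pt3 \<Rightarrow> real) \<Rightarrow> (pt3 \<Rightarrow> real) \<Rightarrow> bool" where
  "cube_density C p \<longleftrightarrow> is_density3 C p \<and> (\<forall>x. x \<notin> I3 \<longrightarrow> p x = 0)"

lemma cube_densityD:
  assumes "cube_density C p"
  shows "integrable lborel p" "p \<in> borel_measurable borel" "0 \<le> p x" "x \<notin> I3 \<Longrightarrow> p x = 0"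
    and "u1 \<in> {0..1} \<Longrightarrow> u2 \<in> {0..1} \<Longrightarrow> v \<in> {0..1} \<Longrightarrow> (\<integral>x\<in>box3 u1 u2 v. p x \<partial>lborel) = C ((u1, u2), v)"
proof -
  have p: "is_density3 C p" and off: "x \<in> I3 \<or> p x = 0" for x
    using assms unfolding cube_density_def by blast+
  then show "p \<in> borel_measurable borel" "x \<notin> I3 \<Longrightarrow> p x = 0"
    unfolding is_density3_def by blast+
  show "0 \<le> p x"
    using p off[of x] unfolding is_density3_def by (cases "x \<in> I3") auto
  have "(\<lambda>x. indicator I3 x *\<^sub>R p x) = p"
    using off by (fastforce simp: indicator_def)
  then show "integrable lborel p"
    using p by (simp add: is_density3_def set_integrable_def)
  show "(\<integral>x\<in>box3 u1 u2 v. p x \<partial>lborel) = C ((u1, u2), v)"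
    if "u1 \<in> {0..1}" "u2 \<in> {0..1}" "v \<in> {0..1}"
    using p that unfolding is_density3_def by metis
qed

lemma cube_density_unique:
  assumes p: "cube_density C p" and q: "cube_density C q"
  shows "AE x in lborel. p x = q x"
proof -
  have "AE x\<in>I3 in lborel. p x = q x"
    using p q by (intro is_density3_unique[of C]) (auto simp: cube_density_def)
  then show ?thesis
  proof eventually_elim
    case (elim x)
    then show ?case
      using cube_densityD(4)[OF p, of x] cube_densityD(4)[OF q, of x] by (cases "x \<in> I3") auto
  qed
qed

lemma cube_density_indicator:
  assumes "is_density3 C c"
  shows "cube_density C (\<lambda>x. indicator I3 x * c x)"
proof -
  have "(\<integral>x\<in>box3 u1 u2 v. indicator I3 x * c x \<partial>lborel) = (\<integral>x\<in>box3 u1 u2 v. c x \<partial>lborel)"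
    if "u1 \<in> {0..1}" "u2 \<in> {0..1}" "v \<in> {0..1}" for u1 u2 v
    using that by (intro set_lebesgue_integral_cong) (auto simp: I3_def)
  moreover have "set_integrable lborel I3 (\<lambda>x. indicator I3 x * c x) = set_integrable lborel I3 c"
    by (intro set_integrable_cong) auto
  moreover have "(\<lambda>x. indicator I3 x * c x) \<in> borel_measurable borel"
    using assms by (auto simp: is_density3_def)
  ultimately show ?thesis
    using assms unfolding cube_density_def is_density3_def by simp
qed

definition copula_density :: "(pt3 \<Rightarrow> real) \<Rightarrow> pt3 \<Rightarrow> real" where
  "copula_density C x = indicator I3 x * density3 C x"

lemma Cac_pos_is_density3:
  assumes "C \<in> Cac_pos"
  shows "is_density3 C (density3 C)"
proof -
  obtain c where "is_density3 C c"
    using assms by (auto simp: Cac_pos_def)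
  then show ?thesis
    unfolding density3_def by (rule someI[of "is_density3 C"])
qed

lemma cube_density_copula_density:
  assumes "C \<in> Cac_pos"
  shows "cube_density C (copula_density C)"
  unfolding copula_density_def[abs_def] by (intro cube_density_indicator Cac_pos_is_density3 assms)

lemma Cac_pos_margins:
  assumes "C \<in> Cac_pos" "x \<in> {0..1}"
  shows "C ((x, 1), 1) = x" "C ((1, x), 1) = x" "C ((1, 1), x) = x"
  using assms by (auto simp: Cac_pos_def is_copula3_def copula3_measure_def measure_def)

lemma
  assumes C: "C \<in> Cac_pos" and p: "cube_density C p"
  shows AE_cube_density_pos: "AE x\<in>I3 in lborel. 0 < p x"
    and integral_cube_density: "(\<integral>x. p x \<partial>lborel) = 1"
proof -
  obtain c where c: "is_density3 C c" "AE x\<in>I3 in lborel. 0 < c x"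
    using C by (auto simp: Cac_pos_def)
  show "AE x\<in>I3 in lborel. 0 < p x"
    using is_density3_unique[OF c(1), of p] p c(2) by (auto simp: cube_density_def elim: eventually_elim2)
  have "(\<integral>x. p x \<partial>lborel) = (\<integral>x\<in>box3 1 1 1. p x \<partial>lborel)"
    unfolding set_lebesgue_integral_def using cube_densityD(4)[OF p]
    by (intro Bochner_Integration.integral_cong) (auto simp: indicator_def I3_def)
  also have "\<dots> = 1"
    using Cac_pos_margins[OF C, of 1] by (simp add: cube_densityD[OF p])
  finally show "(\<integral>x. p x \<partial>lborel) = 1" .
qed

lemma KL_cube_density:
  assumes C: "C \<in> Cac_pos" "D \<in> Cac_pos" and p: "cube_density C p" and q: "cube_density D q"
  shows "KL C D = (if integrable lborel (\<lambda>x. p x * ln (p x / q x))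
     then ereal (\<integral>x. p x * ln (p x / q x) \<partial>lborel) else \<infinity>)"
proof -
  let ?f = "\<lambda>x. density3 C x * ln (density3 C x / density3 D x)" and ?g = "\<lambda>x. p x * ln (p x / q x)"
  have [measurable]: "density3 C \<in> borel_measurable borel" "density3 D \<in> borel_measurable borel"
    using C[THEN Cac_pos_is_density3] by (auto simp: is_density3_def)
  note [measurable] = cube_densityD(2)[OF p] cube_densityD(2)[OF q]
  have "AE x\<in>I3 in lborel. density3 C x = p x" "AE x\<in>I3 in lborel. density3 D x = q x"
    using p q by (auto intro!: is_density3_unique Cac_pos_is_density3 C simp: cube_density_def)
  then have ae: "AE x\<in>I3 in lborel. ?f x = ?g x"
    by eventually_elim auto
  have "(\<lambda>x. indicator I3 x *\<^sub>R ?g x) = ?g"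
    using cube_densityD(4)[OF p] by (auto simp: indicator_def fun_eq_iff)
  then have "set_integrable lborel I3 ?f = integrable lborel ?g"
    "(\<integral>x\<in>I3. ?f x \<partial>lborel) = (\<integral>x. ?g x \<partial>lborel)"
    using set_integrable_cong_AE[OF _ _ ae] set_lebesgue_integral_cong_AE[OF _ _ _ ae]
    by (simp_all add: set_integrable_def set_lebesgue_integral_def)
  then show ?thesis by (simp add: KL_def Let_def)
qed

definition copula_of_density :: "(pt3 \<Rightarrow> real) \<Rightarrow> pt3 \<Rightarrow> real" where
  "copula_of_density q = (\<lambda>((u1, u2), v).
     if ((u1, u2), v) \<in> I3 then \<integral>x\<in>box3 u1 u2 v. q x \<partial>lborel else 0)"

lemma is_copula3_copula_of_density:
  assumes q: "integrable lborel q" "\<And>x. 0 \<le> q x" "\<And>x. x \<notin> I3 \<Longrightarrow> q x = 0"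
    and margins: "\<And>u. u \<in> {0..1} \<Longrightarrow> (\<integral>x\<in>box3 u 1 1. q x \<partial>lborel) = u"
      "\<And>u. u \<in> {0..1} \<Longrightarrow> (\<integral>x\<in>box3 1 u 1. q x \<partial>lborel) = u"
      "\<And>u. u \<in> {0..1} \<Longrightarrow> (\<integral>x\<in>box3 1 1 u. q x \<partial>lborel) = u"
  shows "is_copula3 (copula_of_density q)"
proof -
  define \<mu> where "\<mu> = density lborel (\<lambda>x. ennreal (q x))"
  have \<mu>: "emeasure \<mu> A = ennreal (\<integral>x\<in>A. q x \<partial>lborel)" if "A \<in> sets borel" for A
    unfolding \<mu>_def using emeasure_density_set_integral[OF q(1,2)] that by simp
  have "(\<integral>x\<in>UNIV. q x \<partial>lborel) = (\<integral>x\<in>box3 1 1 1. q x \<partial>lborel)"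
    unfolding set_lebesgue_integral_def using q(3)
    by (intro Bochner_Integration.integral_cong) (auto simp: indicator_def I3_def)
  then have one: "emeasure \<mu> UNIV = 1"
    using margins(1)[of 1] by (simp add: \<mu>)
  have "copula3_measure \<mu> (copula_of_density q)"
    unfolding copula3_measure_def
  proof (intro conjI ballI)
    show "prob_space \<mu>"
      using one by (intro prob_spaceI) (simp add: \<mu>_def)
    show "emeasure \<mu> I3 = 1"
      unfolding I3_def using margins(1)[of 1] by (simp add: \<mu>)
    show "copula_of_density q ((u1, u2), v) = measure \<mu> (box3 u1 u2 v)"
      if "u1 \<in> {0..1}" "u2 \<in> {0..1}" "v \<in> {0..1}" for u1 u2 v
    proof -
      have "0 \<le> (\<integral>x\<in>box3 u1 u2 v. q x \<partial>lborel)"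
        unfolding set_lebesgue_integral_def using q(2) by (intro Bochner_Integration.integral_nonneg) auto
      then show ?thesis
        using that by (simp add: copula_of_density_def I3_def measure_def \<mu>)
    qed
  qed (simp_all add: \<mu> margins, simp add: \<mu>_def)
  then show ?thesis
    by (auto simp: is_copula3_def copula_of_density_def)
qed

lemma cube_density_copula_of_density:
  assumes q: "integrable lborel q" "\<And>x. 0 \<le> q x" "\<And>x. x \<notin> I3 \<Longrightarrow> q x = 0"
  shows "cube_density (copula_of_density q) q"
  unfolding cube_density_def is_density3_def
proof (intro conjI ballI allI impI)
  show "set_integrable lborel I3 q"
    using q(1) by (rule integrable_imp_set_integrable) simp
qed (use q in \<open>auto simp: copula_of_density_def I3_def\<close>)

subsection \<open>Divergence and convergence in mean\<close>

lemma square_sqrt_diff_le_KL_integrand: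
  fixes p q :: real
  assumes "0 \<le> p" "0 < q"
  shows "(sqrt p - sqrt q)\<^sup>2 \<le> p * ln (p / q) - p + q"
proof (cases "p = 0")
  case False
  define a b where "a = sqrt p" and "b = sqrt q"
  have ab: "p = a\<^sup>2" "q = b\<^sup>2" "0 < a" "0 < b"
    using assms False by (auto simp: a_def b_def)
  have "1 - b / a \<le> ln (a / b)"
    using ab ln_le_minus_one[of "b / a"] by (simp add: ln_div)
  then have "2 * a\<^sup>2 * (1 - b / a) \<le> 2 * a\<^sup>2 * ln (a / b)"
    by (intro mult_left_mono) auto
  also have "2 * a\<^sup>2 * ln (a / b) = p * ln (p / q)"
    using ab by (simp add: ln_div ln_realpow algebra_simps)
  also have "2 * a\<^sup>2 * (1 - b / a) = 2 * a\<^sup>2 - 2 * a * b"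
    using ab by (simp add: power2_eq_square field_simps)
  finally show ?thesis
    using ab by (simp add: power2_diff)
qed (use assms in simp)

lemma abs_diff_le_KL_integrand:
  fixes p q \<eta> :: real
  assumes p: "0 \<le> p" and q: "0 \<le> q" and pq: "q = 0 \<Longrightarrow> p = 0" and \<eta>: "0 < \<eta>"
  shows "\<bar>p - q\<bar> \<le> (p * ln (p / q) - p + q) / (2 * \<eta>) + \<eta> * (p + q)"
proof (cases "q = 0")
  case False
  define a b where "a = sqrt p" and "b = sqrt q"
  have ab: "p = a\<^sup>2" "q = b\<^sup>2" "0 \<le> a" "0 \<le> b"
    using p q by (auto simp: a_def b_def)
  have "2 * \<eta> * (\<bar>a - b\<bar> * (a + b)) \<le> (a - b)\<^sup>2 + \<eta>\<^sup>2 * (a + b)\<^sup>2"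
    using sum_squares_bound[of "\<bar>a - b\<bar>" "\<eta> * (a + b)"] by (simp add: power_mult_distrib mult_ac)
  also have "(a + b)\<^sup>2 \<le> 2 * (p + q)"
    using sum_squares_bound[of a b] by (simp add: ab power2_sum)
  also have "(a - b)\<^sup>2 \<le> p * ln (p / q) - p + q"
    unfolding a_def b_def using p q False by (intro square_sqrt_diff_le_KL_integrand) auto
  also have "\<bar>a - b\<bar> * (a + b) = \<bar>p - q\<bar>"
    using ab by (simp add: square_diff_square_factored power2_eq_square abs_mult mult.commute)
  finally show ?thesis
    using \<eta> by (simp add: field_simps power2_eq_square)
qed (use pq in simp)

text \<open>Pinsker's inequality, with \<open>4\<close> in place of the optimal constant \<open>2\<close>.\<close>
lemma square_L1_distance_le_KL:
  fixes p q :: "'a \<Rightarrow> real"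
  assumes p: "integrable M p" "\<And>x. 0 \<le> p x" "integral\<^sup>L M p = 1"
    and q: "integrable M q" "\<And>x. 0 \<le> q x" "integral\<^sup>L M q = 1"
    and pq: "AE x in M. q x = 0 \<longrightarrow> p x = 0"
    and int: "integrable M (\<lambda>x. p x * ln (p x / q x))"
  shows "(\<integral>x. \<bar>p x - q x\<bar> \<partial>M)\<^sup>2 \<le> 4 * (\<integral>x. p x * ln (p x / q x) \<partial>M)"
proof -
  define a K where "a = (\<integral>x. \<bar>p x - q x\<bar> \<partial>M)" and "K = (\<integral>x. p x * ln (p x / q x) \<partial>M)"
  have bound: "a \<le> K / (2 * \<eta>) + 2 * \<eta>" if "0 < \<eta>" for \<eta>
  proof -
    have "a \<le> (\<integral>x. (p x * ln (p x / q x) - p x + q x) / (2 * \<eta>) + \<eta> * (p x + q x) \<partial>M)"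
      unfolding a_def using p q int pq that
      by (intro integral_mono_AE) (auto intro!: abs_diff_le_KL_integrand)
    also have "\<dots> = K / (2 * \<eta>) + 2 * \<eta>"
      using p q int by (simp add: K_def)
    finally show ?thesis .
  qed
  have "0 \<le> a" by (simp add: a_def)
  have "a\<^sup>2 \<le> 4 * K"
  proof (cases "a = 0")
    case True
    have "0 \<le> K"
    proof (rule ccontr)
      assume "\<not> 0 \<le> K"
      then show False
        using bound[of "sqrt (- K) / 4"] True by (simp add: field_simps)
    qed
    with True show ?thesis by simp
  next
    case False
    then show ?thesis
      using bound[of "a / 4"] \<open>0 \<le> a\<close> by (simp add: field_simps power2_eq_square)
  qed
  then show ?thesis by (simp add: a_def K_def)
qed

lemma KL_tendsto_0_imp_L1_tendsto_0:
  assumes s: "\<And>n. s n \<in> Cac_pos" and C: "C \<in> Cac_pos" and lim: "(\<lambda>n. KL (s n) C) \<longlonglongrightarrow> 0"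
  shows "(\<lambda>n. \<integral>x. \<bar>copula_density (s n) x - copula_density C x\<bar> \<partial>lborel) \<longlonglongrightarrow> 0"
proof (rule tendstoI)
  fix e :: real assume e_pos: "0 < e"
  then have "\<forall>\<^sub>F n in sequentially. KL (s n) C < ereal (e\<^sup>2 / 4)"
    using lim by (intro order_tendstoD(2)) auto
  then show "\<forall>\<^sub>F n in sequentially. dist (\<integral>x. \<bar>copula_density (s n) x - copula_density C x\<bar> \<partial>lborel) 0 < e"
  proof eventually_elim
    case (elim n)
    let ?p = "copula_density (s n)" and ?q = "copula_density C"
    note p = cube_density_copula_density[OF s] and q = cube_density_copula_density[OF C]
    have int: "integrable lborel (\<lambda>x. ?p x * ln (?p x / ?q x))"
      and small: "(\<integral>x. ?p x * ln (?p x / ?q x) \<partial>lborel) < e\<^sup>2 / 4"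
      using elim by (auto simp: KL_cube_density[OF s C p q] split: if_splits)
    have "AE x in lborel. ?q x = 0 \<longrightarrow> ?p x = 0"
      using AE_cube_density_pos[OF C q] by eventually_elim (auto simp: copula_density_def)
    then have "(\<integral>x. \<bar>?p x - ?q x\<bar> \<partial>lborel)\<^sup>2 \<le> 4 * (\<integral>x. ?p x * ln (?p x / ?q x) \<partial>lborel)"
      using int by (intro square_L1_distance_le_KL cube_densityD[OF p] cube_densityD[OF q]
          integral_cube_density[OF s p] integral_cube_density[OF C q])
    also have "\<dots> < e\<^sup>2"
      using small by simp
    finally show ?case
      using e_pos by (simp add: power_less_imp_less_base)
  qed
qed

lemma abs_mult_ln_div_le:
  fixes p q \<epsilon> :: real
  assumes "0 \<le> p" "\<bar>q - p\<bar> \<le> \<epsilon> * p" "\<epsilon> \<le> 1/2"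
  shows "\<bar>q * ln (q / p)\<bar> \<le> 3 * \<epsilon> * p"
proof (cases "p = 0")
  case False
  define y where "y = q / p - 1"
  have q: "q = p * (1 + y)" using False by (simp add: y_def)
  have y: "\<bar>y\<bar> \<le> \<epsilon>"
    using assms(1,2) False by (simp add: q algebra_simps abs_mult)
  have "\<bar>ln (1 + y) - y\<bar> \<le> 2 * y\<^sup>2"
    using y assms(3) by (intro abs_ln_one_plus_x_minus_x_bound) linarith
  also have "2 * y\<^sup>2 \<le> \<bar>y\<bar>"
  proof -
    have "\<bar>y\<bar> * \<bar>y\<bar> \<le> \<bar>y\<bar> * (1/2)"
      using y assms(3) by (intro mult_left_mono) auto
    then show ?thesis by (simp add: power2_eq_square)
  qed
  finally have "\<bar>ln (1 + y)\<bar> \<le> 2 * \<epsilon>" using y by linarith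
  then have "\<bar>1 + y\<bar> * \<bar>ln (1 + y)\<bar> \<le> (3/2) * (2 * \<epsilon>)"
    using y assms(3) by (intro mult_mono) auto
  then have "p * (\<bar>1 + y\<bar> * \<bar>ln (1 + y)\<bar>) \<le> p * ((3/2) * (2 * \<epsilon>))"
    using assms(1) by (intro mult_left_mono) auto
  then show ?thesis
    using False assms(1) by (simp add: q abs_mult mult_ac)
qed (use assms in auto)

lemma KL_perturbation_bound:
  assumes C: "C \<in> Cac_pos" "D \<in> Cac_pos" and p: "cube_density C p" and q: "cube_density D q"
    and diff: "\<And>x. \<bar>q x - p x\<bar> \<le> \<epsilon> * p x" and \<epsilon>: "\<epsilon> \<le> 1/2"
  obtains r where "KL D C = ereal r" "\<bar>r\<bar> \<le> 3 * \<epsilon>"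
proof -
  note [measurable] = cube_densityD(2)[OF p] cube_densityD(2)[OF q]
  have bound: "\<bar>q x * ln (q x / p x)\<bar> \<le> 3 * \<epsilon> * p x" for x
    using cube_densityD(3)[OF p] diff \<epsilon> by (rule abs_mult_ln_div_le)
  have int_p: "integrable lborel (\<lambda>x. 3 * \<epsilon> * p x)"
    using cube_densityD(1)[OF p] by simp
  have int: "integrable lborel (\<lambda>x. q x * ln (q x / p x))"
    using order_trans[OF bound abs_ge_self]
    by (intro Bochner_Integration.integrable_bound[OF int_p]) (auto intro!: AE_I2)
  have "\<bar>\<integral>x. q x * ln (q x / p x) \<partial>lborel\<bar> \<le> (\<integral>x. \<bar>q x * ln (q x / p x)\<bar> \<partial>lborel)"
    by (rule integral_abs_bound)
  also have "\<dots> \<le> (\<integral>x. 3 * \<epsilon> * p x \<partial>lborel)"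
    using int int_p bound by (intro integral_mono) auto
  also have "\<dots> = 3 * \<epsilon>"
    using integral_cube_density[OF C(1) p] by simp
  finally show ?thesis
    using that int by (simp add: KL_cube_density[OF C(2,1) q p])
qed

subsection \<open>A Lipschitz condition on conditional distribution functions\<close>

text \<open>If \<open>p\<close> is the density of a copula \<open>C\<close>, then \<open>cond_df p u1 u2 t\<close> is \<open>K\<^sub>C(t, [0, u1] \<times> [0, u2])\<close>; the cases \<open>u2 = 1\<close> and
  \<open>u1 = 1\<close> are \<open>F\<^sub>1\<^sub>|\<^sub>3(u1 | t)\<close> and \<open>F\<^sub>2\<^sub>|\<^sub>3(u2 | t)\<close>.\<close>
abbreviation cond_df :: "(pt3 \<Rightarrow> real) \<Rightarrow> real \<Rightarrow> real \<Rightarrow> real \<Rightarrow> real" where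
  "cond_df p u1 u2 \<equiv> slice p ({0..u1} \<times> {0..u2})"

definition cond_df_lipschitz_at :: "(pt3 \<Rightarrow> real) \<Rightarrow> real \<Rightarrow> real \<Rightarrow> real \<Rightarrow> real \<Rightarrow> bool" where
  "cond_df_lipschitz_at p u1 u2 s t \<longleftrightarrow> \<bar>cond_df p u1 u2 s - cond_df p u1 u2 t\<bar> \<le>
     \<bar>cond_df p u1 1 s - cond_df p u1 1 t\<bar> + \<bar>cond_df p 1 u2 s - cond_df p 1 u2 t\<bar>"

definition cond_df_lipschitz :: "(pt3 \<Rightarrow> real) \<Rightarrow> real \<Rightarrow> real \<Rightarrow> bool" where
  "cond_df_lipschitz p u1 u2 \<longleftrightarrow>
     (AE s\<in>{0..1} in lborel. AE t\<in>{0..1} in lborel. cond_df_lipschitz_at p u1 u2 s t)"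

lemma cond_df_lipschitz_at_limit:
  assumes s: "\<And>E. E \<in> sets borel \<Longrightarrow> (\<lambda>n. slice (p n) E s) \<longlonglongrightarrow> slice q E s"
    and t: "\<And>E. E \<in> sets borel \<Longrightarrow> (\<lambda>n. slice (p n) E t) \<longlonglongrightarrow> slice q E t"
    and lip: "\<And>n. cond_df_lipschitz_at (p n) u1 u2 s t"
  shows "cond_df_lipschitz_at q u1 u2 s t"
  unfolding cond_df_lipschitz_at_def
proof (rule LIMSEQ_le)
  show "\<exists>N. \<forall>n\<ge>N. \<bar>cond_df (p n) u1 u2 s - cond_df (p n) u1 u2 t\<bar> \<le>
     \<bar>cond_df (p n) u1 1 s - cond_df (p n) u1 1 t\<bar> + \<bar>cond_df (p n) 1 u2 s - cond_df (p n) 1 u2 t\<bar>"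
    using lip by (auto simp: cond_df_lipschitz_at_def)
qed (intro tendsto_intros s t borel_Times_Icc)+

lemma cond_df_lipschitz_L1_limit:
  assumes p: "\<And>n. integrable lborel (p n)" and q: "integrable lborel q"
    and lip: "\<And>n. cond_df_lipschitz (p n) u1 u2"
    and lim: "(\<lambda>n. \<integral>x. \<bar>p n x - q x\<bar> \<partial>lborel) \<longlonglongrightarrow> 0"
  shows "cond_df_lipschitz q u1 u2"
proof -
  obtain r where conv: "AE t in lborel. \<forall>E\<in>sets borel. (\<lambda>n. slice (p (r n)) E t) \<longlonglongrightarrow> slice q E t"
    using L1_tendsto_imp_AE_slice_tendsto_subseq[OF p q lim] by blast
  have "AE s in lborel. \<forall>n. s \<in> {0..1} \<longrightarrow> (AE t\<in>{0..1} in lborel. cond_df_lipschitz_at (p (r n)) u1 u2 s t)"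
    unfolding AE_all_countable using lip by (simp add: cond_df_lipschitz_def)
  with conv show ?thesis
    unfolding cond_df_lipschitz_def
  proof eventually_elim
    case s: (elim s)
    show ?case
    proof
      assume "s \<in> {0..1}"
      with s have "AE t in lborel. \<forall>n. t \<in> {0..1} \<longrightarrow> cond_df_lipschitz_at (p (r n)) u1 u2 s t"
        unfolding AE_all_countable by blast
      with conv show "AE t\<in>{0..1} in lborel. cond_df_lipschitz_at q u1 u2 s t"
      proof eventually_elim
        case t: (elim t)
        show ?case
          by (rule impI, rule cond_df_lipschitz_at_limit[of "\<lambda>n. p (r n)"]) (use s(1) t in auto)
      qed
    qed
  qed
qed

lemma cond_df_lipschitz_AE_cong:
  assumes "integrable lborel p" "integrable lborel q" "AE x in lborel. p x = q x" "cond_df_lipschitz p u1 u2"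
  shows "cond_df_lipschitz q u1 u2"
proof (rule cond_df_lipschitz_L1_limit[where p = "\<lambda>_. p"])
  have "(\<integral>x. \<bar>p x - q x\<bar> \<partial>lborel) = (\<integral>x. 0 \<partial>(lborel :: pt3 measure))"
    using assms by (intro integral_cong_AE) auto
  then show "(\<lambda>n. \<integral>x. \<bar>p x - q x\<bar> \<partial>lborel) \<longlonglongrightarrow> 0"
    by simp
qed (use assms in auto)

lemma not_cond_df_lipschitzI:
  assumes A: "A \<in> sets lborel" "A \<subseteq> {0..1}" "emeasure lborel A \<noteq> 0"
    and B: "B \<in> sets lborel" "B \<subseteq> {0..1}" "emeasure lborel B \<noteq> 0"
    and P: "AE t in lborel. P t"
    and not_at: "\<And>s t. s \<in> A \<Longrightarrow> t \<in> B \<Longrightarrow> P s \<Longrightarrow> P t \<Longrightarrow> \<not> cond_df_lipschitz_at p u1 u2 s t"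
  shows "\<not> cond_df_lipschitz p u1 u2"
proof
  assume "cond_df_lipschitz p u1 u2"
  then have "AE s in lborel. P s \<and> (s \<in> {0..1} \<longrightarrow> (AE t\<in>{0..1} in lborel. cond_df_lipschitz_at p u1 u2 s t))"
    unfolding cond_df_lipschitz_def using P by (rule AE_conjI[rotated])
  then obtain s where s: "s \<in> A" "P s \<and> (s \<in> {0..1} \<longrightarrow> (AE t\<in>{0..1} in lborel. cond_df_lipschitz_at p u1 u2 s t))"
    using A(1,3) by (rule AE_obtain_in_positive_set)
  with A(2) have "AE t\<in>{0..1} in lborel. cond_df_lipschitz_at p u1 u2 s t"
    by blast
  with P have "AE t in lborel. P t \<and> (t \<in> {0..1} \<longrightarrow> cond_df_lipschitz_at p u1 u2 s t)"
    by (rule AE_conjI)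
  then obtain t where "t \<in> B" "P t \<and> (t \<in> {0..1} \<longrightarrow> cond_df_lipschitz_at p u1 u2 s t)"
    using B(1,3) by (rule AE_obtain_in_positive_set)
  with not_at s B(2) show False by blast
qed

definition cond_df_close :: "(pt3 \<Rightarrow> real) \<Rightarrow> real \<Rightarrow> real \<Rightarrow> real \<Rightarrow> real \<Rightarrow> real \<Rightarrow> bool" where
  "cond_df_close p u1 u2 e s t \<longleftrightarrow> \<bar>cond_df p u1 u2 s - cond_df p u1 u2 t\<bar> < e \<and>
     \<bar>cond_df p u1 1 s - cond_df p u1 1 t\<bar> < e \<and> \<bar>cond_df p 1 u2 s - cond_df p 1 u2 t\<bar> < e"

lemma positive_measure_cond_df_close:
  assumes p: "integrable lborel p" and A: "A \<in> sets lborel" "emeasure lborel A \<noteq> 0" and e_pos: "0 < e"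
  obtains B where "B \<in> sets lborel" "B \<subseteq> A" "emeasure lborel B \<noteq> 0"
    "\<And>s t. s \<in> B \<Longrightarrow> t \<in> B \<Longrightarrow> cond_df_close p u1 u2 e s t"
proof -
  have [measurable]: "cond_df p v1 v2 \<in> borel_measurable lborel" for v1 v2
    using p by (intro borel_measurable_integrable integrable_slice) auto
  define F where "F t = (cond_df p u1 u2 t, cond_df p u1 1 t, cond_df p 1 u2 t)" for t
  have "F \<in> borel_measurable lborel"
    unfolding F_def by measurable
  then obtain B where B: "B \<in> sets lborel" "B \<subseteq> A" "emeasure lborel B \<noteq> 0"
    and osc: "\<And>s t. s \<in> B \<Longrightarrow> t \<in> B \<Longrightarrow> dist (F s) (F t) < e"
    using positive_measure_small_oscillation[OF _ A e_pos] by metis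
  have "cond_df_close p u1 u2 e s t" if "s \<in> B" "t \<in> B" for s t
    using osc[OF that] dist_fst_le[of "F s" "F t"] dist_snd_le[of "F s" "F t"]
      dist_fst_le[of "snd (F s)" "snd (F t)"] dist_snd_le[of "snd (F s)" "snd (F t)"]
    by (simp add: F_def cond_df_close_def dist_real_def)
  with B show ?thesis by (rule that)
qed

subsection \<open>Simplified copulas\<close>

lemma copula2_measure_strip:
  assumes \<mu>: "copula2_measure \<mu> A" and "0 \<le> x" "x \<le> y" "y \<le> 1"
  shows "measure \<mu> ({x<..y} \<times> {0..1}) = y - x" "measure \<mu> ({0..1} \<times> {x<..y}) = y - x"
proof -
  interpret prob_space \<mu> using \<mu> by (simp add: copula2_measure_def)
  have [simp]: "sets \<mu> = sets borel" using \<mu> by (simp add: copula2_measure_def)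
  have margins: "prob ({0..z} \<times> {0..1}) = z" "prob ({0..1} \<times> {0..z}) = z" if "z \<in> {0..1}" for z
    using \<mu> that by (auto simp: copula2_measure_def measure_def)
  have "{x<..y} \<times> {0..1} = {0..y} \<times> {0..1} - {0..x} \<times> {0..1::real}"
    "{0..1} \<times> {x<..y} = {0..1} \<times> {0..y} - {0..1::real} \<times> {0..x}"
    using assms by auto
  moreover have sub: "{0..x} \<times> {0..1} \<subseteq> {0..y} \<times> {0..1::real}" "{0..1} \<times> {0..x} \<subseteq> {0..1::real} \<times> {0..y}"
    using assms by auto
  ultimately show "prob ({x<..y} \<times> {0..1}) = y - x" "prob ({0..1} \<times> {x<..y}) = y - x"
    using assms margins[of x] margins[of y] by (simp_all add: finite_measure_Diff[OF _ _ sub(1)]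
        finite_measure_Diff[OF _ _ sub(2)])
qed

lemma copula2_lipschitz:
  assumes A: "is_copula2 A" and I: "(a, b) \<in> I2" "(a', b') \<in> I2"
  shows "\<bar>A (a, b) - A (a', b')\<bar> \<le> \<bar>a - a'\<bar> + \<bar>b - b'\<bar>"
proof -
  obtain \<mu> where \<mu>: "copula2_measure \<mu> A"
    using A by (auto simp: is_copula2_def)
  then interpret prob_space \<mu> by (simp add: copula2_measure_def)
  have [simp]: "sets \<mu> = sets borel" using \<mu> by (simp add: copula2_measure_def)
  define V where "V = {min a a'<..max a a'} \<times> {0..1::real}"
  define H where "H = {0..1::real} \<times> {min b b'<..max b b'}"
  have VH: "V \<in> events" "H \<in> events"
    by (auto simp: V_def H_def intro!: borel_Times)
  have "\<bar>A (a, b) - A (a', b')\<bar> = \<bar>prob ({0..a} \<times> {0..b}) - prob ({0..a'} \<times> {0..b'})\<bar>"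
    using \<mu> I by (simp add: copula2_measure_def I2_def)
  also have "\<dots> \<le> prob (V \<union> H)"
    using VH I by (intro abs_measure_diff_le) (auto simp: V_def H_def I2_def)
  also have "\<dots> \<le> prob V + prob H"
    using VH by (rule measure_Un_le)
  also have "\<dots> = \<bar>a - a'\<bar> + \<bar>b - b'\<bar>"
    using I by (auto simp: V_def H_def I2_def copula2_measure_strip[OF \<mu>] min_def max_def)
  finally show ?thesis .
qed

lemma copula2_in_unit:
  assumes "is_copula2 A"
  shows "A z \<in> {0..1}"
proof (cases "z \<in> I2")
  case True
  then show ?thesis
    using assms by (cases z) (auto simp: is_copula2_def copula2_measure_def I2_def prob_space.prob_le_1)
next
  case False
  then have "A z = 0" using assms unfolding is_copula2_def by blast
  then show ?thesis by simp
qed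

lemma borel_measurable_copula2:
  assumes A: "is_copula2 A"
  shows "A \<in> borel_measurable borel"
proof -
  have "2-lipschitz_on I2 A"
  proof (rule lipschitz_onI)
    fix z w assume zw: "z \<in> I2" "w \<in> I2"
    have "dist (A z) (A w) \<le> dist (fst z) (fst w) + dist (snd z) (snd w)"
      using copula2_lipschitz[OF A, of "fst z" "snd z" "fst w" "snd w"] zw by (simp add: dist_real_def)
    then show "dist (A z) (A w) \<le> 2 * dist z w"
      using dist_fst_le[of z w] dist_snd_le[of z w] by linarith
  qed simp
  moreover have "I2 \<in> sets borel"
    by (simp add: I2_def)
  ultimately have "(\<lambda>z. indicator I2 z *\<^sub>R A z) \<in> borel_measurable borel"
    by (intro borel_measurable_continuous_on_indicator lipschitz_on_continuous_on)
  moreover have "(\<lambda>z. indicator I2 z *\<^sub>R A z) = A"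
    using A by (intro ext) (auto simp: is_copula2_def indicator_def simp del: split_paired_All)
  ultimately show ?thesis by simp
qed

lemma cond_kernel_measure_Times:
  assumes K: "cond_kernel \<mu> K" and E: "E \<in> sets borel" and F: "F \<in> sets borel"
  shows "measure \<mu> (E \<times> F) = (\<integral>t\<in>F \<inter> {0..1}. measure (K t) E \<partial>lborel)"
proof -
  have [measurable]: "(\<lambda>t. measure (K t) E) \<in> borel_measurable borel"
    and K_prob: "prob_space (K t)" for t
    using K E by (auto simp: cond_kernel_def)
  have "emeasure \<mu> (E \<times> F) = (\<integral>\<^sup>+ t. indicator (F \<inter> {0..1}) t * emeasure (K t) E \<partial>lborel)"
    using K E F unfolding cond_kernel_def by blast
  also have "\<dots> = (\<integral>\<^sup>+ t. ennreal (indicator (F \<inter> {0..1}) t *\<^sub>R measure (K t) E) \<partial>lborel)"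
    using finite_measure.emeasure_eq_measure[OF prob_space.finite_measure[OF K_prob]]
    by (intro nn_integral_cong) (simp add: ennreal_mult' ennreal_indicator)
  finally show ?thesis
    unfolding set_lebesgue_integral_def measure_def[of \<mu>]
    using F by (subst integral_eq_nn_integral) auto
qed

lemma
  assumes p: "cube_density C p"
  shows set_integrable_cond_df: "set_integrable lborel {0..1} (cond_df p u1 u2)"
    and cond_df_nonneg: "0 \<le> cond_df p u1 u2 t"
    and set_integral_cond_df: "u1 \<in> {0..1} \<Longrightarrow> u2 \<in> {0..1} \<Longrightarrow> v \<in> {0..1} \<Longrightarrow>
      (\<integral>t\<in>{0..v}. cond_df p u1 u2 t \<partial>lborel) = C ((u1, u2), v)"
proof -
  show "set_integrable lborel {0..1} (cond_df p u1 u2)"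
    using cube_densityD(1)[OF p] by (intro integrable_imp_set_integrable integrable_slice) auto
  show "0 \<le> cond_df p u1 u2 t"
    unfolding slice_def set_lebesgue_integral_def
    by (intro Bochner_Integration.integral_nonneg) (simp add: cube_densityD(3)[OF p])
  show "(\<integral>t\<in>{0..v}. cond_df p u1 u2 t \<partial>lborel) = C ((u1, u2), v)"
    if "u1 \<in> {0..1}" "u2 \<in> {0..1}" "v \<in> {0..1}"
    using cube_densityD(5)[OF p that] set_integral_Times_eq_slice[OF cube_densityD(1)[OF p]] by simp
qed

lemma AE_cond_df_eq_kernel:
  assumes \<mu>: "copula3_measure \<mu> C" and K: "cond_kernel \<mu> K" and p: "cube_density C p"
    and u: "u1 \<in> {0..1}" "u2 \<in> {0..1}"
  shows "AE t\<in>{0..1} in lborel. cond_df p u1 u2 t = measure (K t) ({0..u1} \<times> {0..u2})"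
proof (rule AE_eq_on_Icc_if_set_integral_eq)
  show "set_integrable lborel {0..1} (\<lambda>t. measure (K t) ({0..u1} \<times> {0..u2}))"
    using K by (intro set_integrable_lborel_bounded[where K = 1]) (auto simp: cond_kernel_def prob_space.prob_le_1)
  fix v :: real assume v: "v \<in> {0..1}"
  have "(\<integral>t\<in>{0..v}. cond_df p u1 u2 t \<partial>lborel) = C ((u1, u2), v)"
    using p u v by (rule set_integral_cond_df)
  also have "\<dots> = measure \<mu> (box3 u1 u2 v)"
    using \<mu> u v by (simp add: copula3_measure_def)
  also have "\<dots> = (\<integral>t\<in>{0..v} \<inter> {0..1}. measure (K t) ({0..u1} \<times> {0..u2}) \<partial>lborel)"
    using K by (intro cond_kernel_measure_Times) auto
  also have "{0..v} \<inter> {0..1} = {0..v}" using v by auto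
  finally show "(\<integral>t\<in>{0..v}. cond_df p u1 u2 t \<partial>lborel) =
      (\<integral>t\<in>{0..v}. measure (K t) ({0..u1} \<times> {0..u2}) \<partial>lborel)" .
qed (use set_integrable_cond_df[OF p] cond_df_nonneg[OF p] in auto)

lemma simplified_AE_cond_df_eq_copula:
  assumes C: "simplified C" and p: "cube_density C p" and u: "u1 \<in> {0..1}" "u2 \<in> {0..1}"
  obtains A where "is_copula2 A"
    "AE t\<in>{0..1} in lborel.
      (cond_df p u1 1 t, cond_df p 1 u2 t) \<in> I2 \<and> cond_df p u1 u2 t = A (cond_df p u1 1 t, cond_df p 1 u2 t)"
proof -
  obtain \<mu> K A where \<mu>: "copula3_measure \<mu> C" and K: "cond_kernel \<mu> K" and A: "is_copula2 A"
    and C_eq: "\<forall>u1\<in>{0..1}. \<forall>u2\<in>{0..1}. \<forall>v\<in>{0..1}.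
      C ((u1, u2), v) = (\<integral>t\<in>{0..v}. A (F13 K u1 t, F23 K u2 t) \<partial>lborel)"
    using C unfolding simplified_def by blast
  note [measurable] = borel_measurable_copula2[OF A]
  have [measurable]: "F13 K u \<in> borel_measurable borel" "F23 K u \<in> borel_measurable borel" for u
    using K by (auto simp: cond_kernel_def F13_def[abs_def] F23_def[abs_def])
  have F_I2: "(F13 K u1 t, F23 K u2 t) \<in> I2" for u1 u2 t
    using K by (simp add: I2_def F13_def F23_def cond_kernel_def prob_space.prob_le_1)
  have "AE t\<in>{0..1} in lborel. cond_df p u1 u2 t = A (F13 K u1 t, F23 K u2 t)"
  proof (rule AE_eq_on_Icc_if_set_integral_eq)
    show "set_integrable lborel {0..1} (\<lambda>t. A (F13 K u1 t, F23 K u2 t))"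
      using copula2_in_unit[OF A] by (intro set_integrable_lborel_bounded[where K = 1]) auto
  qed (use set_integrable_cond_df[OF p] cond_df_nonneg[OF p] set_integral_cond_df[OF p u] C_eq u
      copula2_in_unit[OF A] in auto)
  moreover have "AE t\<in>{0..1} in lborel. cond_df p u1 1 t = F13 K u1 t"
    unfolding F13_def using \<mu> K p u by (intro AE_cond_df_eq_kernel) auto
  moreover have "AE t\<in>{0..1} in lborel. cond_df p 1 u2 t = F23 K u2 t"
    unfolding F23_def using \<mu> K p u by (intro AE_cond_df_eq_kernel) auto
  ultimately have "AE t\<in>{0..1} in lborel.
      (cond_df p u1 1 t, cond_df p 1 u2 t) \<in> I2 \<and> cond_df p u1 u2 t = A (cond_df p u1 1 t, cond_df p 1 u2 t)"
    by eventually_elim (use F_I2 in auto)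
  with A show ?thesis by (rule that)
qed

lemma simplified_imp_cond_df_lipschitz:
  assumes C: "simplified C" and p: "cube_density C p" and u: "u1 \<in> {0..1}" "u2 \<in> {0..1}"
  shows "cond_df_lipschitz p u1 u2"
proof -
  obtain A where A: "is_copula2 A" and eq: "AE t\<in>{0..1} in lborel.
      (cond_df p u1 1 t, cond_df p 1 u2 t) \<in> I2 \<and> cond_df p u1 u2 t = A (cond_df p u1 1 t, cond_df p 1 u2 t)"
    by (rule simplified_AE_cond_df_eq_copula[OF C p u])
  show ?thesis
    unfolding cond_df_lipschitz_def using eq
  proof eventually_elim
    case s: (elim s)
    show ?case
    proof
      assume "s \<in> {0..1}"
      with s have at_s: "(cond_df p u1 1 s, cond_df p 1 u2 s) \<in> I2"
        "cond_df p u1 u2 s = A (cond_df p u1 1 s, cond_df p 1 u2 s)"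
        by auto
      from eq show "AE t\<in>{0..1} in lborel. cond_df_lipschitz_at p u1 u2 s t"
        unfolding cond_df_lipschitz_at_def at_s(2)
        by eventually_elim (use copula2_lipschitz[OF A at_s(1)] in auto)
    qed
  qed
qed

subsection \<open>Alternating functions on the square\<close>

definition reflect_fst :: "real \<times> real \<Rightarrow> real \<times> real" where
  "reflect_fst = map_prod (\<lambda>a. 1 - a) (\<lambda>b. b)"

definition reflect_snd :: "real \<times> real \<Rightarrow> real \<times> real" where
  "reflect_snd = map_prod (\<lambda>a. a) (\<lambda>b. 1 - b)"

lemma borel_measurable_reflect [measurable]:
  "reflect_fst \<in> borel_measurable borel" "reflect_snd \<in> borel_measurable borel"
  unfolding reflect_fst_def reflect_snd_def map_prod_def case_prod_beta' by (simp_all flip: borel_prod)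

lemma distr_lborel_reflect:
  "distr lborel borel reflect_fst = lborel" "distr lborel borel reflect_snd = lborel"
proof -
  have "distr lborel borel (\<lambda>a::real. 1 - a) = lborel"
    using lborel_real_affine[of "-1" 1] by (simp add: density_1)
  moreover have "distr lborel borel (\<lambda>b::real. b) = lborel"
    by (metis distr_cong distr_id sets_lborel)
  ultimately show "distr lborel borel reflect_fst = lborel" "distr lborel borel reflect_snd = lborel"
    unfolding reflect_fst_def reflect_snd_def by (auto intro!: distr_lborel_map_prod)
qed

definition alternating :: "(real \<times> real \<Rightarrow> real) \<Rightarrow> real \<times> real \<Rightarrow> real" where
  "alternating f u = sgn (1/2 - fst u) * sgn (1/2 - snd u) *
     min (min (f u) (f (reflect_fst u))) (min (f (reflect_snd u)) (f (reflect_fst (reflect_snd u))))"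

lemma abs_alternating_le:
  assumes "\<And>u. 0 \<le> f u"
  shows "\<bar>alternating f u\<bar> \<le> f u"
proof -
  have "\<bar>alternating f u\<bar> \<le> 1 * f u"
    unfolding alternating_def abs_mult using assms by (intro mult_mono) (auto simp: abs_sgn_eq)
  then show ?thesis by simp
qed

lemma alternating_reflect:
  "alternating f (reflect_fst u) = - alternating f u" "alternating f (reflect_snd u) = - alternating f u"
  by (cases u; auto simp: alternating_def reflect_fst_def reflect_snd_def sgn_real_def
      min.commute min.left_commute min.assoc)+

lemma borel_measurable_fst_snd [measurable]:
  "fst \<in> borel_measurable (borel :: ('a::second_countable_topology \<times> 'b::second_countable_topology) measure)"
  "snd \<in> borel_measurable (borel :: ('a::second_countable_topology \<times> 'b::second_countable_topology) measure)"
  by (simp_all flip: borel_prod)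

lemma borel_measurable_alternating [measurable]:
  assumes [measurable]: "f \<in> borel_measurable borel"
  shows "alternating f \<in> borel_measurable borel"
  unfolding alternating_def[abs_def] sgn_real_def by measurable

lemma integrable_alternating:
  assumes "integrable lborel f" "\<And>u. 0 \<le> f u"
  shows "integrable lborel (alternating f)"
  using assms abs_alternating_le[of f]
  by (intro Bochner_Integration.integrable_bound[OF assms(1)]) auto

lemma set_integral_alternating_strip_eq_0:
  assumes [measurable]: "f \<in> borel_measurable borel"
  shows "(\<integral>u\<in>{0..x} \<times> {0..1}. alternating f u \<partial>lborel) = 0"
    and "(\<integral>u\<in>{0..1} \<times> {0..x}. alternating f u \<partial>lborel) = 0"
proof -
  have meas: "set_borel_measurable lborel ({a..b} \<times> {c..d}) (alternating f)" for a b c d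
    unfolding set_borel_measurable_def by measurable
  show "(\<integral>u\<in>{0..x} \<times> {0..1}. alternating f u \<partial>lborel) = 0"
  proof (rule set_integral_antisymmetric_eq_0[OF _ distr_lborel_reflect(2) meas])
    show "reflect_snd u \<in> {0..x} \<times> {0..1} \<longleftrightarrow> u \<in> {0..x} \<times> {0..1}" for u
      by (cases u) (auto simp: reflect_snd_def)
  qed (simp_all add: alternating_reflect)
  show "(\<integral>u\<in>{0..1} \<times> {0..x}. alternating f u \<partial>lborel) = 0"
  proof (rule set_integral_antisymmetric_eq_0[OF _ distr_lborel_reflect(1) meas])
    show "reflect_fst u \<in> {0..1} \<times> {0..x} \<longleftrightarrow> u \<in> {0..1} \<times> {0..x}" for u
      by (cases u) (auto simp: reflect_fst_def)
  qed (simp_all add: alternating_reflect)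
qed

lemma AE_alternating_pos:
  assumes pos: "AE u\<in>I2 in lborel. 0 < f u"
  shows "AE u\<in>{0..<1/2} \<times> {0..<1/2} in lborel. 0 < alternating f u"
proof -
  have refl: "AE u in lborel. T u \<in> I2 \<longrightarrow> P (T u)"
    if "AE u\<in>I2 in lborel. P u" "T \<in> borel_measurable borel" "distr lborel borel T = lborel"
    for P and T :: "real \<times> real \<Rightarrow> real \<times> real"
  proof (rule AE_distrD[where P = "\<lambda>u. u \<in> I2 \<longrightarrow> P u" and M' = borel])
    show "AE u in distr lborel borel T. u \<in> I2 \<longrightarrow> P u"
      unfolding that(3) by (rule that(1))
  qed (use that(2) in simp)
  note fst = refl[OF _ borel_measurable_reflect(1) distr_lborel_reflect(1)]
    and snd = refl[OF _ borel_measurable_reflect(2) distr_lborel_reflect(2)]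
  have "AE u\<in>I2 in lborel. reflect_fst u \<in> I2 \<longrightarrow> 0 < f (reflect_fst u)"
    using fst[OF pos] by eventually_elim simp
  from pos fst[OF pos] snd[OF pos] snd[OF this] show ?thesis
  proof eventually_elim
    case (elim u)
    show ?case
    proof
      assume u: "u \<in> {0..<1/2} \<times> {0..<1/2}"
      then have "u \<in> I2" "reflect_fst u \<in> I2" "reflect_snd u \<in> I2" "reflect_fst (reflect_snd u) \<in> I2"
        by (auto simp: I2_def reflect_fst_def reflect_snd_def)
      with elim u show "0 < alternating f u"
        by (auto simp: alternating_def)
    qed
  qed
qed

lemma set_integral_alternating_quarter_pos:
  assumes f: "integrable lborel f" "\<And>u. 0 \<le> f u" and pos: "AE u\<in>I2 in lborel. 0 < f u"
  shows "0 < (\<integral>u\<in>{0..1/2} \<times> {0..1/2}. alternating f u \<partial>lborel)"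
proof -
  let ?S = "{0..<1/2} \<times> {0..<1/2} :: (real \<times> real) set"
  have S: "?S \<in> sets lborel"
    by (auto intro!: borel_Times)
  have "emeasure lborel ?S = ennreal (1/2) * ennreal (1/2)"
    unfolding lborel_prod[symmetric] by (subst lborel.emeasure_pair_measure_Times) auto
  then have "?S \<notin> null_sets lborel"
    by (auto simp: ennreal_mult[symmetric])
  then have "(\<integral>u\<in>?S. alternating f u \<partial>lborel) \<noteq> 0"
    using null_if_pos_func_has_zero_int[OF integrable_alternating[OF f] S AE_alternating_pos[OF pos]] by blast
  moreover have "0 \<le> alternating f u" if "u \<in> ?S" for u
    using that by (simp add: alternating_def mem_Times_iff f(2))
  then have "0 \<le> (\<integral>u\<in>?S. alternating f u \<partial>lborel)"
    unfolding set_lebesgue_integral_def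
    by (intro Bochner_Integration.integral_nonneg) (simp add: indicator_def)
  moreover have "(\<integral>u\<in>{0..1/2} \<times> {0..1/2}. alternating f u \<partial>lborel) = (\<integral>u\<in>?S. alternating f u \<partial>lborel)"
    unfolding set_lebesgue_integral_def
    by (intro Bochner_Integration.integral_cong)
      (auto simp: alternating_def indicator_def sgn_real_def split: if_splits)
  ultimately show ?thesis by linarith
qed

subsection \<open>Tilted densities\<close>

definition alternating_sections :: "(pt3 \<Rightarrow> real) \<Rightarrow> pt3 \<Rightarrow> real" where
  "alternating_sections p x = alternating (\<lambda>u. p (u, snd x)) (fst x)"

lemma slice_alternating_sections:
  "slice (alternating_sections p) E t = (\<integral>u\<in>E. alternating (\<lambda>u. p (u, t)) u \<partial>lborel)"
  by (simp add: slice_def alternating_sections_def)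

lemma abs_alternating_sections_le:
  assumes "\<And>x. 0 \<le> p x"
  shows "\<bar>alternating_sections p x\<bar> \<le> p x"
  using abs_alternating_le[of "\<lambda>u. p (u, snd x)" "fst x"] assms by (simp add: alternating_sections_def)

lemma borel_measurable_alternating_sections:
  assumes "p \<in> borel_measurable borel"
  shows "alternating_sections p \<in> borel_measurable borel"
proof -
  have [measurable]: "p \<in> borel_measurable (borel \<Otimes>\<^sub>M borel)"
    using assms by (simp add: borel_prod)
  have "alternating_sections p \<in> borel_measurable (borel \<Otimes>\<^sub>M borel)"
    unfolding alternating_sections_def[abs_def] alternating_def sgn_real_def by measurable
  then show ?thesis by (simp add: borel_prod)
qed

lemma integrable_alternating_sections:
  assumes "integrable lborel p" "\<And>x. 0 \<le> p x"
  shows "integrable lborel (alternating_sections p)"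
  using assms abs_alternating_sections_le[of p] borel_measurable_alternating_sections[of p]
  by (intro Bochner_Integration.integrable_bound[OF assms(1)]) auto

lemma slice_alternating_sections_strip_eq_0:
  assumes "p \<in> borel_measurable borel"
  shows "slice (alternating_sections p) ({0..u} \<times> {0..1}) t = 0"
    and "slice (alternating_sections p) ({0..1} \<times> {0..u}) t = 0"
proof -
  have "(\<lambda>u. p (u, t)) \<in> borel_measurable borel"
    using assms by measurable
  then show "slice (alternating_sections p) ({0..u} \<times> {0..1}) t = 0"
    "slice (alternating_sections p) ({0..1} \<times> {0..u}) t = 0"
    by (simp_all only: slice_alternating_sections set_integral_alternating_strip_eq_0)
qed

lemma AE_slice_alternating_sections_quarter_pos:
  assumes p: "integrable lborel p" "\<And>x. 0 \<le> p x" and pos: "AE x\<in>I3 in lborel. 0 < p x"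
  shows "AE t\<in>{0..1} in lborel. 0 < slice (alternating_sections p) ({0..1/2} \<times> {0..1/2}) t"
  using AE_section[OF pos] AE_integrable_section[OF p(1)]
proof eventually_elim
  case (elim t)
  show ?case
  proof
    assume "t \<in> {0..1}"
    with elim(1) have "AE u\<in>I2 in lborel. 0 < p (u, t)"
      by (simp add: I2_def I3_def)
    then show "0 < slice (alternating_sections p) ({0..1/2} \<times> {0..1/2}) t"
      unfolding slice_alternating_sections
      using elim(2) p(2) by (intro set_integral_alternating_quarter_pos)
  qed
qed

definition tilt :: "real \<Rightarrow> real set \<Rightarrow> (pt3 \<Rightarrow> real) \<Rightarrow> pt3 \<Rightarrow> real" where
  "tilt \<epsilon> B p x = p x + \<epsilon> * indicator B (snd x) * alternating_sections p x"

lemma abs_tilt_diff_le: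
  assumes "\<And>x. 0 \<le> p x" "0 \<le> \<epsilon>"
  shows "\<bar>tilt \<epsilon> B p x - p x\<bar> \<le> \<epsilon> * p x"
  using abs_alternating_sections_le[of p x] assms
  by (auto simp: tilt_def indicator_def abs_mult intro: mult_left_mono)

lemma integrable_tilt:
  assumes p: "integrable lborel p" "\<And>x. 0 \<le> p x" and B: "B \<in> sets borel"
  shows "integrable lborel (tilt \<epsilon> B p)"
proof -
  have "UNIV \<times> B \<in> sets (lborel :: pt3 measure)"
    using B by (simp add: borel_Times)
  then have "integrable lborel (\<lambda>x. indicator (UNIV \<times> B) x *\<^sub>R alternating_sections p x)"
    using integrable_alternating_sections[OF p] by (rule integrable_mult_indicator)
  moreover have "tilt \<epsilon> B p = (\<lambda>x. p x + \<epsilon> * (indicator (UNIV \<times> B) x *\<^sub>R alternating_sections p x))"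
    by (auto simp: tilt_def indicator_def)
  ultimately show ?thesis using p(1) by simp
qed

lemma AE_slice_tilt:
  assumes p: "integrable lborel p" "\<And>x. 0 \<le> p x"
  shows "AE t in lborel. \<forall>E\<in>sets borel.
    slice (tilt \<epsilon> B p) E t = slice p E t + \<epsilon> * indicator B t * slice (alternating_sections p) E t"
  using AE_integrable_section[OF p(1)] AE_integrable_section[OF integrable_alternating_sections[OF p]]
proof eventually_elim
  case (elim t)
  show ?case
  proof
    fix E :: "(real \<times> real) set" assume "E \<in> sets borel"
    then have "set_integrable lborel E (\<lambda>u. p (u, t))"
      "set_integrable lborel E (\<lambda>u. alternating_sections p (u, t))"
      using elim by (auto intro: integrable_imp_set_integrable)
    then show "slice (tilt \<epsilon> B p) E t = slice p E t + \<epsilon> * indicator B t * slice (alternating_sections p) E t"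
      by (simp add: slice_def tilt_def)
  qed
qed

lemma set_integral_tilt_margins:
  assumes p: "integrable lborel p" "\<And>x. 0 \<le> p x" and B: "B \<in> sets borel"
  shows "(\<integral>x\<in>box3 u 1 v. tilt \<epsilon> B p x \<partial>lborel) = (\<integral>x\<in>box3 u 1 v. p x \<partial>lborel)"
    and "(\<integral>x\<in>box3 1 u v. tilt \<epsilon> B p x \<partial>lborel) = (\<integral>x\<in>box3 1 u v. p x \<partial>lborel)"
proof -
  have p_meas: "p \<in> borel_measurable borel"
    using p(1) by auto
  have invariant: "(\<integral>x\<in>E \<times> {0..v}. tilt \<epsilon> B p x \<partial>lborel) = (\<integral>x\<in>E \<times> {0..v}. p x \<partial>lborel)"
    if E: "E \<in> sets borel" and "\<And>t. slice (alternating_sections p) E t = 0" for E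
  proof -
    have "AE t\<in>{0..v} in lborel. slice (tilt \<epsilon> B p) E t = slice p E t"
      using AE_slice_tilt[OF p, of \<epsilon> B] by eventually_elim (use that in auto)
    then have "(\<integral>t\<in>{0..v}. slice (tilt \<epsilon> B p) E t \<partial>lborel) = (\<integral>t\<in>{0..v}. slice p E t \<partial>lborel)"
      using integrable_slice[OF integrable_tilt[OF p B] E] integrable_slice[OF p(1) E]
      by (intro set_lebesgue_integral_cong_AE) auto
    then show ?thesis
      using E by (simp add: set_integral_Times_eq_slice integrable_tilt[OF p B] p(1))
  qed
  show "(\<integral>x\<in>box3 u 1 v. tilt \<epsilon> B p x \<partial>lborel) = (\<integral>x\<in>box3 u 1 v. p x \<partial>lborel)"
    "(\<integral>x\<in>box3 1 u v. tilt \<epsilon> B p x \<partial>lborel) = (\<integral>x\<in>box3 1 u v. p x \<partial>lborel)"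
    by (intro invariant slice_alternating_sections_strip_eq_0[OF p_meas] borel_Times_Icc)+
qed

lemma
  assumes p: "cube_density C p" and \<epsilon>: "0 \<le> \<epsilon>" "\<epsilon> < 1"
  shows tilt_nonneg: "0 \<le> tilt \<epsilon> B p x"
    and tilt_pos: "0 < p x \<Longrightarrow> 0 < tilt \<epsilon> B p x"
    and tilt_eq_0: "x \<notin> I3 \<Longrightarrow> tilt \<epsilon> B p x = 0"
proof -
  have diff: "\<bar>tilt \<epsilon> B p x - p x\<bar> \<le> \<epsilon> * p x"
    using cube_densityD(3)[OF p] \<epsilon>(1) by (intro abs_tilt_diff_le) auto
  then have ge: "(1 - \<epsilon>) * p x \<le> tilt \<epsilon> B p x"
    by (simp add: algebra_simps abs_le_iff)
  have "0 \<le> (1 - \<epsilon>) * p x"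
    using \<epsilon>(2) cube_densityD(3)[OF p, of x] by simp
  then show "0 \<le> tilt \<epsilon> B p x"
    using ge by linarith
  show "0 < tilt \<epsilon> B p x" if "0 < p x"
  proof -
    have "0 < (1 - \<epsilon>) * p x"
      using \<epsilon>(2) that by simp
    then show ?thesis
      using ge by linarith
  qed
  show "tilt \<epsilon> B p x = 0" if "x \<notin> I3"
    using diff cube_densityD(4)[OF p that] by simp
qed

lemma Cac_pos_tilt:
  assumes C: "C \<in> Cac_pos" and p: "cube_density C p" and \<epsilon>: "0 \<le> \<epsilon>" "\<epsilon> < 1" and B: "B \<in> sets borel"
  shows "copula_of_density (tilt \<epsilon> B p) \<in> Cac_pos"
    and "cube_density (copula_of_density (tilt \<epsilon> B p)) (tilt \<epsilon> B p)"
proof -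
  let ?q = "tilt \<epsilon> B p"
  note p_int = cube_densityD(1)[OF p] and p_nonneg = cube_densityD(3)[OF p]
  note q = integrable_tilt[OF p_int p_nonneg B] tilt_nonneg[OF p \<epsilon>] tilt_eq_0[OF p \<epsilon>]
  show density: "cube_density (copula_of_density ?q) ?q"
    using q by (rule cube_density_copula_of_density)
  have "is_copula3 (copula_of_density ?q)"
    using q by (rule is_copula3_copula_of_density)
      (simp_all add: set_integral_tilt_margins[OF p_int p_nonneg B] cube_densityD(5)[OF p] Cac_pos_margins[OF C])
  moreover have "AE x\<in>I3 in lborel. 0 < ?q x"
    using AE_cube_density_pos[OF C p]
    by eventually_elim (use tilt_pos[OF p \<epsilon>] in blast)
  ultimately show "copula_of_density ?q \<in> Cac_pos"
    using density by (auto simp: Cac_pos_def cube_density_def)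
qed

lemma AE_cond_df_tilt:
  assumes p: "integrable lborel p" "\<And>x. 0 \<le> p x"
  shows "AE t in lborel. cond_df (tilt \<epsilon> B p) u1 1 t = cond_df p u1 1 t \<and>
    cond_df (tilt \<epsilon> B p) 1 u2 t = cond_df p 1 u2 t \<and>
    cond_df (tilt \<epsilon> B p) u1 u2 t = cond_df p u1 u2 t + \<epsilon> * indicator B t * cond_df (alternating_sections p) u1 u2 t"
  using AE_slice_tilt[OF p, of \<epsilon> B]
  by eventually_elim (use p(1) in \<open>simp add: slice_alternating_sections_strip_eq_0\<close>)

lemma positive_measure_alternating_sections_ge_cond_df_close:
  assumes p: "integrable lborel p" "\<And>x. 0 \<le> p x" and pos: "AE x\<in>I3 in lborel. 0 < p x"
    and c_pos: "0 < c"
  obtains P \<delta> where "P \<in> sets lborel" "P \<subseteq> {0..1}" "emeasure lborel P \<noteq> 0"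
    "0 < \<delta>" "\<And>t. t \<in> P \<Longrightarrow> \<delta> \<le> cond_df (alternating_sections p) (1/2) (1/2) t"
    "\<And>s t. s \<in> P \<Longrightarrow> t \<in> P \<Longrightarrow> cond_df_close p (1/2) (1/2) (c * \<delta>) s t"
proof -
  let ?m = "cond_df (alternating_sections p) (1/2) (1/2)"
  obtain A \<delta> where A: "A \<in> sets lborel" "A \<subseteq> {0..1}" "emeasure lborel A \<noteq> 0"
    and \<delta>: "0 < \<delta>" "\<And>t. t \<in> A \<Longrightarrow> \<delta> \<le> ?m t"
  proof (rule positive_measure_bounded_below)
    show "?m \<in> borel_measurable lborel"
      using integrable_slice[OF integrable_alternating_sections[OF p]] by auto
    show "AE t\<in>{0..1} in lborel. 0 < ?m t"
      using p pos by (rule AE_slice_alternating_sections_quarter_pos)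
  qed auto
  have "0 < c * \<delta>" using c_pos \<delta>(1) by simp
  with p(1) A(1,3) obtain P where "P \<in> sets lborel" "P \<subseteq> A" "emeasure lborel P \<noteq> 0"
    "\<And>s t. s \<in> P \<Longrightarrow> t \<in> P \<Longrightarrow> cond_df_close p (1/2) (1/2) (c * \<delta>) s t"
    by (rule positive_measure_cond_df_close) (rule that)
  with A(2) \<delta> show ?thesis
    by (intro that[of P \<delta>]) auto
qed

lemma exists_tilt_not_cond_df_lipschitz:
  assumes p: "integrable lborel p" "\<And>x. 0 \<le> p x" and pos: "AE x\<in>I3 in lborel. 0 < p x"
    and \<epsilon>: "0 < \<epsilon>"
  obtains B where "B \<in> sets borel" "\<not> cond_df_lipschitz (tilt \<epsilon> B p) (1/2) (1/2)"
proof -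
  let ?m = "cond_df (alternating_sections p) (1/2) (1/2)"
  have "0 < \<epsilon> / 3" using \<epsilon> by simp
  with p pos obtain P \<delta> where P: "P \<in> sets lborel" "P \<subseteq> {0..1}" "emeasure lborel P \<noteq> 0"
    and "0 < \<delta>" and m_ge: "\<And>t. t \<in> P \<Longrightarrow> \<delta> \<le> ?m t"
    and close: "\<And>s t. s \<in> P \<Longrightarrow> t \<in> P \<Longrightarrow> cond_df_close p (1/2) (1/2) (\<epsilon> / 3 * \<delta>) s t"
    by (rule positive_measure_alternating_sections_ge_cond_df_close) (rule that)
  obtain B where B: "B \<in> sets lborel" "B \<subseteq> P" "emeasure lborel B \<noteq> 0" "emeasure lborel (P - B) \<noteq> 0"
    using atomless_split_positive_measure[of lborel P] P(1,3) by auto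
  let ?q = "tilt \<epsilon> B p"
  define regular where "regular t \<longleftrightarrow> cond_df ?q (1/2) 1 t = cond_df p (1/2) 1 t \<and>
    cond_df ?q 1 (1/2) t = cond_df p 1 (1/2) t \<and>
    cond_df ?q (1/2) (1/2) t = cond_df p (1/2) (1/2) t + \<epsilon> * indicator B t * ?m t" for t
  have regular: "AE t in lborel. regular t"
    unfolding regular_def using p by (rule AE_cond_df_tilt)
  have "\<not> cond_df_lipschitz ?q (1/2) (1/2)"
  proof (rule not_cond_df_lipschitzI[OF B(1) _ B(3) _ _ B(4) regular])
    fix s t assume s: "s \<in> B" "regular s" and t: "t \<in> P - B" "regular t"
    then have "s \<in> P" "t \<in> P"
      using B(2) by auto
    have "cond_df ?q (1/2) (1/2) s - cond_df ?q (1/2) (1/2) t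
        = cond_df p (1/2) (1/2) s - cond_df p (1/2) (1/2) t + \<epsilon> * ?m s"
      using s t by (simp add: regular_def)
    moreover have "\<bar>cond_df p (1/2) (1/2) s - cond_df p (1/2) (1/2) t\<bar> < \<epsilon> / 3 * \<delta>"
      using close[OF \<open>s \<in> P\<close> \<open>t \<in> P\<close>] by (simp add: cond_df_close_def)
    moreover have "\<epsilon> * \<delta> \<le> \<epsilon> * ?m s"
      using \<epsilon> m_ge[OF \<open>s \<in> P\<close>] by simp
    ultimately have "2 * (\<epsilon> / 3 * \<delta>) < \<bar>cond_df ?q (1/2) (1/2) s - cond_df ?q (1/2) (1/2) t\<bar>"
      by linarith
    moreover have "\<bar>cond_df ?q (1/2) 1 s - cond_df ?q (1/2) 1 t\<bar> < \<epsilon> / 3 * \<delta>"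
      "\<bar>cond_df ?q 1 (1/2) s - cond_df ?q 1 (1/2) t\<bar> < \<epsilon> / 3 * \<delta>"
      using s t close[OF \<open>s \<in> P\<close> \<open>t \<in> P\<close>] by (auto simp: regular_def cond_df_close_def)
    ultimately show "\<not> cond_df_lipschitz_at ?q (1/2) (1/2) s t"
      unfolding cond_df_lipschitz_at_def by linarith
  qed (use P B in auto)
  then show ?thesis using that[of B] B(1) by simp
qed

lemma exists_KL_near_not_cond_df_lipschitz:
  assumes C: "C \<in> Cac_pos" and \<epsilon>: "0 < \<epsilon>" "\<epsilon> \<le> 1/2"
  obtains D r where "D \<in> Cac_pos" "\<not> cond_df_lipschitz (copula_density D) (1/2) (1/2)"
    "KL D C = ereal r" "\<bar>r\<bar> \<le> 3 * \<epsilon>"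
proof -
  let ?p = "copula_density C"
  note p = cube_density_copula_density[OF C]
  obtain B where B: "B \<in> sets borel" "\<not> cond_df_lipschitz (tilt \<epsilon> B ?p) (1/2) (1/2)"
    by (rule exists_tilt_not_cond_df_lipschitz[OF cube_densityD(1,3)[OF p] AE_cube_density_pos[OF C p] \<epsilon>(1)])
  let ?q = "tilt \<epsilon> B ?p"
  define D where "D = copula_of_density ?q"
  have D: "D \<in> Cac_pos" "cube_density D ?q"
    unfolding D_def using C p \<epsilon> B(1) by (auto intro!: Cac_pos_tilt)
  have diff: "\<bar>?q x - ?p x\<bar> \<le> \<epsilon> * ?p x" for x
    using cube_densityD(3)[OF p] \<epsilon>(1) by (intro abs_tilt_diff_le) auto
  obtain r where "KL D C = ereal r" "\<bar>r\<bar> \<le> 3 * \<epsilon>"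
    by (rule KL_perturbation_bound[OF C D(1) p D(2) diff \<epsilon>(2)])
  moreover have "\<not> cond_df_lipschitz (copula_density D) (1/2) (1/2)"
    using cond_df_lipschitz_AE_cong[OF _ _ cube_density_unique[OF _ D(2)]] B(2)
      cube_density_copula_density[OF D(1)] cube_densityD(1) D(2) by blast
  ultimately show ?thesis using that D(1) by blast
qed

subsection \<open>The Kullback--Leibler topology\<close>

lemma istopology_sequential:
  "istopology (\<lambda>U. U \<subseteq> X \<and> (\<forall>x\<in>U. \<forall>s. (\<forall>n. s n \<in> X) \<and> conv s x \<longrightarrow> (\<forall>\<^sub>F n in sequentially. s n \<in> U)))"
  unfolding istopology_def
proof (intro conjI allI impI)
  let ?open = "\<lambda>U. U \<subseteq> X \<and> (\<forall>x\<in>U. \<forall>s. (\<forall>n. s n \<in> X) \<and> conv s x \<longrightarrow> (\<forall>\<^sub>F n in sequentially. s n \<in> U))"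
  show "U \<inter> V \<subseteq> X" if "?open U" for U V
    using that by blast
  show "\<forall>x\<in>U \<inter> V. \<forall>s. (\<forall>n. s n \<in> X) \<and> conv s x \<longrightarrow> (\<forall>\<^sub>F n in sequentially. s n \<in> U \<inter> V)"
    if "?open U" "?open V" for U V
    using that by (auto simp: eventually_conj_iff)
  show "\<Union>\<K> \<subseteq> X" if "\<forall>U\<in>\<K>. ?open U" for \<K>
    using that by blast
  show "\<forall>x\<in>\<Union>\<K>. \<forall>s. (\<forall>n. s n \<in> X) \<and> conv s x \<longrightarrow> (\<forall>\<^sub>F n in sequentially. s n \<in> \<Union>\<K>)"
    if "\<forall>U\<in>\<K>. ?open U" for \<K>
  proof (intro ballI allI impI)
    fix x s assume "x \<in> \<Union>\<K>" and s: "(\<forall>n. s n \<in> X) \<and> conv s x"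
    then obtain U where U: "U \<in> \<K>" "x \<in> U" by blast
    then have "\<forall>\<^sub>F n in sequentially. s n \<in> U"
      using that s by blast
    then show "\<forall>\<^sub>F n in sequentially. s n \<in> \<Union>\<K>"
      by eventually_elim (use U in blast)
  qed
qed

lemma openin_KL_top:
  "openin KL_top U \<longleftrightarrow> U \<subseteq> Cac_pos \<and>
     (\<forall>C\<in>U. \<forall>s. (\<forall>n. s n \<in> Cac_pos) \<and> (\<lambda>n. KL (s n) C) \<longlonglongrightarrow> 0
       \<longrightarrow> (\<forall>\<^sub>F n in sequentially. s n \<in> U))"
  unfolding KL_top_def
  by (subst topology_inverse'[OF istopology_sequential[where conv = "\<lambda>s C. (\<lambda>n. KL (s n) C) \<longlonglongrightarrow> 0"]]) rule

lemma topspace_KL_top: "topspace KL_top = Cac_pos"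
proof
  show "topspace KL_top \<subseteq> Cac_pos"
    unfolding topspace_def by (auto simp: openin_KL_top)
  show "Cac_pos \<subseteq> topspace KL_top"
    by (rule openin_subset) (simp add: openin_KL_top)
qed

lemma closedin_KL_top_sequentially:
  assumes T: "T \<subseteq> Cac_pos"
    and closed: "\<And>s C. (\<And>n. s n \<in> T) \<Longrightarrow> C \<in> Cac_pos \<Longrightarrow> (\<lambda>n. KL (s n) C) \<longlonglongrightarrow> 0 \<Longrightarrow> C \<in> T"
  shows "closedin KL_top T"
  unfolding closedin_def topspace_KL_top openin_KL_top
proof (intro conjI ballI allI impI T)
  fix C s assume C: "C \<in> Cac_pos - T" and s: "(\<forall>n. s n \<in> Cac_pos) \<and> (\<lambda>n. KL (s n) C) \<longlonglongrightarrow> 0"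
  show "\<forall>\<^sub>F n in sequentially. s n \<in> Cac_pos - T"
  proof (rule ccontr)
    assume "\<not> ?thesis"
    then have "\<exists>\<^sub>F n in sequentially. s n \<in> T"
      using s by (simp add: not_eventually)
    then have "infinite {n. s n \<in> T}"
      by (simp add: cofinite_eq_sequentially[symmetric] frequently_cofinite)
    then obtain r :: "nat \<Rightarrow> nat" where r: "strict_mono r" "\<And>n. s (r n) \<in> T"
      using infinite_enumerate by blast
    have "(\<lambda>n. KL (s (r n)) C) \<longlonglongrightarrow> 0"
      using LIMSEQ_subseq_LIMSEQ[OF conjunct2[OF s] r(1)] by (simp add: o_def)
    then have "C \<in> T"
      using closed[of "\<lambda>n. s (r n)"] r(2) C by blast
    then show False using C by blast
  qed
qed auto

lemma interior_of_KL_top_eq_empty: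
  assumes "\<And>C. C \<in> Cac_pos \<Longrightarrow> \<exists>s. (\<forall>n. s n \<in> Cac_pos - T) \<and> (\<lambda>n. KL (s n) C) \<longlonglongrightarrow> 0"
  shows "KL_top interior_of T = {}"
proof (rule ccontr)
  assume "\<not> ?thesis"
  then obtain U C where U: "openin KL_top U" "C \<in> U" "U \<subseteq> T"
    by (auto simp: interior_of_def)
  then obtain s where s: "\<And>n. s n \<in> Cac_pos - T" "(\<lambda>n. KL (s n) C) \<longlonglongrightarrow> 0"
    using assms[of C] by (auto simp: openin_KL_top)
  then have "\<forall>\<^sub>F n in sequentially. s n \<in> U"
    using U by (simp add: openin_KL_top)
  then obtain n where "s n \<in> U"
    using eventually_happens by fastforce
  then show False using U(3) s(1) by blast
qed

definition lipschitz_copulas :: "(pt3 \<Rightarrow> real) set" where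
  "lipschitz_copulas = {C \<in> Cac_pos. cond_df_lipschitz (copula_density C) (1/2) (1/2)}"

lemma simplified_subset_lipschitz_copulas: "{C \<in> Cac_pos. simplified C} \<subseteq> lipschitz_copulas"
  unfolding lipschitz_copulas_def
  by (auto intro: simplified_imp_cond_df_lipschitz cube_density_copula_density)

lemma closedin_lipschitz_copulas: "closedin KL_top lipschitz_copulas"
proof (rule closedin_KL_top_sequentially)
  fix s C assume s: "\<And>n. s n \<in> lipschitz_copulas" and C: "C \<in> Cac_pos" and lim: "(\<lambda>n. KL (s n) C) \<longlonglongrightarrow> 0"
  have s_Cac_pos: "s n \<in> Cac_pos" for n
    using s by (simp add: lipschitz_copulas_def)
  have "cond_df_lipschitz (copula_density C) (1/2) (1/2)"
  proof (rule cond_df_lipschitz_L1_limit)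
    show "integrable lborel (copula_density (s n))" "integrable lborel (copula_density C)" for n
      using s_Cac_pos C by (blast intro: cube_densityD(1) cube_density_copula_density)+
    show "(\<lambda>n. \<integral>x. \<bar>copula_density (s n) x - copula_density C x\<bar> \<partial>lborel) \<longlonglongrightarrow> 0"
      using s_Cac_pos C lim by (rule KL_tendsto_0_imp_L1_tendsto_0)
  qed (use s in \<open>simp add: lipschitz_copulas_def\<close>)
  with C show "C \<in> lipschitz_copulas"
    by (simp add: lipschitz_copulas_def)
qed (auto simp: lipschitz_copulas_def)

lemma interior_of_lipschitz_copulas: "KL_top interior_of lipschitz_copulas = {}"
proof (rule interior_of_KL_top_eq_empty)
  fix C assume C: "C \<in> Cac_pos"
  define \<epsilon> where "\<epsilon> n = 1 / real (n + 2)" for n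
  have "\<exists>D r. D \<in> Cac_pos - lipschitz_copulas \<and> KL D C = ereal r \<and> \<bar>r\<bar> \<le> 3 * \<epsilon> n" for n
    by (rule exists_KL_near_not_cond_df_lipschitz[OF C, of "\<epsilon> n"]) (auto simp: \<epsilon>_def lipschitz_copulas_def)
  then obtain s r where s: "\<And>n. s n \<in> Cac_pos - lipschitz_copulas"
    and r: "\<And>n. KL (s n) C = ereal (r n)" "\<And>n. \<bar>r n\<bar> \<le> 3 * \<epsilon> n"
    by metis
  have "\<epsilon> \<longlonglongrightarrow> 0"
    unfolding \<epsilon>_def using LIMSEQ_ignore_initial_segment[OF lim_1_over_n, of 2] by simp
  then have "(\<lambda>n. 3 * \<epsilon> n) \<longlonglongrightarrow> 0"
    by (rule tendsto_mult_right_zero)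
  then have "r \<longlonglongrightarrow> 0"
    by (rule Lim_null_comparison[rotated]) (use r(2) in simp)
  then have "(\<lambda>n. KL (s n) C) \<longlonglongrightarrow> 0"
    by (simp add: r(1) zero_ereal_def)
  with s show "\<exists>s. (\<forall>n. s n \<in> Cac_pos - lipschitz_copulas) \<and> (\<lambda>n. KL (s n) C) \<longlonglongrightarrow> 0"
    by blast
qed

theorem theorem3p11:
  shows "KL_top interior_of (KL_top closure_of {C \<in> Cac_pos. simplified C}) = {}"
proof -
  have "KL_top closure_of {C \<in> Cac_pos. simplified C} \<subseteq> lipschitz_copulas"
    using simplified_subset_lipschitz_copulas closedin_lipschitz_copulas by (rule closure_of_minimal)
  then have "KL_top interior_of (KL_top closure_of {C \<in> Cac_pos. simplified C})
      \<subseteq> KL_top interior_of lipschitz_copulas"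
    by (rule interior_of_mono)
  then show ?thesis
    by (simp add: interior_of_lipschitz_copulas)
qed

end
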